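(* Let $K\ge2$ and let $o'$ be a vertex of the $(K+1)$-regular infinite tree $\mathcal T$ with root $o$ such that $d(o,o')$ is odd. For $\ell>d(o,o')$, consider the coloring process on the finite tree $\mathcal T^{(\ell)}$ with a blue seed at $o$ and a red seed at $o'$, and assume that all processes are constructed using the same arrival times and the same tie-breaking indexings. Let $\tilde B^{(\ell)}$ and $\tilde R^{(\ell)}$ be the resulting sets of blue and red vertices. Then $(\tilde B^{(\ell)},\tilde R^{(\ell)})_{\ell>d(o,o')}$ converges almost surely in the local topology to some random sets $(\tilde B^{(\infty)},\tilde R^{(\infty)})$. Moreover: (a) $\tilde B^{(\infty)}\cap\{v\in\mathcal T: d(v,o)>d(v,o')\}$ is a.s. finite; (b) $\tilde R^{(\infty)}\cap\{v\in\mathcal T: d(v,o)<d(v,o')\}$ is a.s. finite.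
   Context: $K\ge2$ is a fixed integer; $\mathcal T$ is the infinite tree in which every vertex has $K+1$ neighbors, with root $o$, graph distance $d$ and balls $B(v,r)$. $\mathcal T^{(\ell)}=\mathcal T\cap B(o,\ell)$. For each $w\in\mathcal T$, a uniform increasing indexing centered at $w$ is a random enumeration $(z_j^w)_{j\ge1}$ of all vertices of $\mathcal T$ without repetition, such that $j<i$ implies $d(w,z_j^w)\le d(w,z_i^w)$, and such that for each $r$ the induced order on the vertices at distance $r$ from $w$ is uniform and independent of the orders induced at the other distances. Let $(\tau_v)_{v\ne o,o'}$ be i.i.d. with an atomless distribution on $(0,\infty)$, set $\tau_o=\tau_{o'}=0$, and let the indexings $((z_j^w)_{j\ge1})_{w\in\mathcal T}$ be independent of each other and of the arrival times. Coloring of $\mathcal T^{(\ell)}$: the parent of a non-seed vertex $v\in\mathcal T^{(\ell)}$ is the first vertex in the indexing centered at $v$ that belongs to $\mathcal T^{(\ell)}$ and has arrival time strictly smaller than $\tau_v$. Iterating the parent map from $v$ leads to one of the seeds $o$ (blue) or $o'$ (red), and $v$ takes the color of this seed. Almost sure local convergence means that a.s., for every $N\ge0$, the coloring of $\mathcal T^{(\ell)}$ restricted to $B(o,N)$ coincides with the restriction of the limit for all $\ell$ large enough. *)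

theory Defs
  imports "HOL-Probability.Probability"
begin

text \<open>
  A graph is given by its adjacency relation; the vertices are the elements of the type.
  The notion of tree in the AFP entry \<open>Graph_Theory\<close> is not suitable, because in a symmetric
  digraph every edge traversed back and forth counts as a cycle there.
\<close>

definition is_tree :: "('v \<Rightarrow> 'v \<Rightarrow> bool) \<Rightarrow> bool" where
  "is_tree E \<longleftrightarrow> symp E \<and> irreflp E \<and> (\<forall>u v. E\<^sup>*\<^sup>* u v) \<and>
     \<not> (\<exists>xs. length xs \<ge> 3 \<and> distinct xs \<and> successively E xs \<and> E (last xs) (hd xs))"

definition regular_tree :: "nat \<Rightarrow> ('v \<Rightarrow> 'v \<Rightarrow> bool) \<Rightarrow> bool" where
  "regular_tree k E \<longleftrightarrow> is_tree E \<and> (\<forall>v. finite {u. E v u} \<and> card {u. E v u} = k)"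

definition gdist :: "('v \<Rightarrow> 'v \<Rightarrow> bool) \<Rightarrow> 'v \<Rightarrow> 'v \<Rightarrow> nat" where
  "gdist E u v = (LEAST n. (E ^^ n) u v)"

definition gball :: "('v \<Rightarrow> 'v \<Rightarrow> bool) \<Rightarrow> 'v \<Rightarrow> nat \<Rightarrow> 'v set" where
  "gball E v r = {u. gdist E v u \<le> r}"

definition gsphere :: "('v \<Rightarrow> 'v \<Rightarrow> bool) \<Rightarrow> 'v \<Rightarrow> nat \<Rightarrow> 'v set" where
  "gsphere E v r = {u. gdist E v u = r}"

text \<open>
  Enumerations of the vertices are numbered from 0, so \<open>e j\<close> is the vertex of index
  \<open>j + 1\<close> in a numbering that starts at 1.  Only the order of the vertices matters.
\<close>

definition induced_order :: "'v set \<Rightarrow> (nat \<Rightarrow> 'v) \<Rightarrow> ('v \<times> 'v) set" where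
  "induced_order S e = {(e i, e j) | i j. i \<le> j \<and> e i \<in> S \<and> e j \<in> S}"

definition enum_space :: "(nat \<Rightarrow> 'v) measure" where
  "enum_space = (\<Pi>\<^sub>M j\<in>UNIV. count_space UNIV)"

definition uniform_increasing_indexing ::
    "('v \<Rightarrow> 'v \<Rightarrow> bool) \<Rightarrow> 'w measure \<Rightarrow> 'v \<Rightarrow> ('w \<Rightarrow> nat \<Rightarrow> 'v) \<Rightarrow> bool" where
  "uniform_increasing_indexing E M w z \<longleftrightarrow>
     z \<in> M \<rightarrow>\<^sub>M enum_space \<and>
     (AE \<omega> in M. bij (z \<omega>) \<and> (\<forall>i j. j < i \<longrightarrow> gdist E w (z \<omega> j) \<le> gdist E w (z \<omega> i))) \<and>
     (\<forall>r. distr M (count_space UNIV) (\<lambda>\<omega>. induced_order (gsphere E w r) (z \<omega>))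
            = measure_pmf (pmf_of_set {R. linear_order_on (gsphere E w r) R})) \<and>
     prob_space.indep_vars M (\<lambda>r. count_space UNIV)
       (\<lambda>r \<omega>. induced_order (gsphere E w r) (z \<omega>)) UNIV"

text \<open>
  Here \<open>t\<close> are the arrival times, \<open>e v\<close> is the indexing centered at \<open>v\<close>, \<open>a\<close> is both the
  root and the blue seed, and \<open>b\<close> is the red seed.  The parent map is extended by letting it
  fix the two seeds, so that iterating it stops at the first seed that is reached.
\<close>

definition parent ::
    "('v \<Rightarrow> 'v \<Rightarrow> bool) \<Rightarrow> 'v \<Rightarrow> 'v \<Rightarrow> nat \<Rightarrow> ('v \<Rightarrow> real) \<Rightarrow> ('v \<Rightarrow> nat \<Rightarrow> 'v) \<Rightarrow> 'v \<Rightarrow> 'v" where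
  "parent E a b l t e v =
     (if v \<in> {a, b} then v
      else e v (LEAST j. e v j \<in> gball E a l \<and> t (e v j) < t v))"

definition blue_set ::
    "('v \<Rightarrow> 'v \<Rightarrow> bool) \<Rightarrow> 'v \<Rightarrow> 'v \<Rightarrow> nat \<Rightarrow> ('v \<Rightarrow> real) \<Rightarrow> ('v \<Rightarrow> nat \<Rightarrow> 'v) \<Rightarrow> 'v set" where
  "blue_set E a b l t e = {v \<in> gball E a l. \<exists>n. (parent E a b l t e ^^ n) v = a}"

definition red_set ::
    "('v \<Rightarrow> 'v \<Rightarrow> bool) \<Rightarrow> 'v \<Rightarrow> 'v \<Rightarrow> nat \<Rightarrow> ('v \<Rightarrow> real) \<Rightarrow> ('v \<Rightarrow> nat \<Rightarrow> 'v) \<Rightarrow> 'v set" where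
  "red_set E a b l t e = {v \<in> gball E a l. \<exists>n. (parent E a b l t e ^^ n) v = b}"

definition random_vertex_set :: "'w measure \<Rightarrow> ('w \<Rightarrow> 'v set) \<Rightarrow> bool" where
  "random_vertex_set M X \<longleftrightarrow> (\<forall>v. {\<omega> \<in> space M. v \<in> X \<omega>} \<in> sets M)"

text \<open>
  Local convergence of the sequence of pairs \<open>(B l, R l)\<close> indexed by \<open>l > m\<close>; the values
  at \<open>l \<le> m\<close> play no role.
\<close>

definition locally_converges ::
    "('v \<Rightarrow> 'v \<Rightarrow> bool) \<Rightarrow> 'v \<Rightarrow> nat \<Rightarrow> (nat \<Rightarrow> 'v set) \<Rightarrow> (nat \<Rightarrow> 'v set) \<Rightarrow> 'v set \<Rightarrow> 'v set \<Rightarrow> bool"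
  where
  "locally_converges E a m B R Binf Rinf \<longleftrightarrow>
     (\<forall>N. \<exists>L > m. \<forall>l \<ge> L. B l \<inter> gball E a N = Binf \<inter> gball E a N \<and>
                          R l \<inter> gball E a N = Rinf \<inter> gball E a N)"

end

theory Submission
  imports Defs
begin

text \<open>
  The heart of the matter is that almost surely every vertex \<open>u\<close> other than the seeds has only
  finitely many descendants, even when the descendants in the trees truncated at all levels
  \<open>l\<close> are collected (\<open>AE_finite_descendants\<close>). The limit coloring cannot be read off from
  the parent map of the infinite tree, since there the line of ancestors of a vertex may escape to
  infinity without ever meeting a seed. Uniformity in \<open>l\<close> is what makes up for this.

  From finiteness to convergence. Suppose that \<open>v\<close> is closer to the seed \<open>c'\<close> but gets the
  color of the other seed \<open>c\<close>. Then its line of ancestors jumps from the half-tree of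
  \<open>c'\<close> to that of \<open>c\<close>. The seed \<open>c'\<close> is itself a possible parent, so the jump is not
  longer than the distance to \<open>c'\<close>, and by tree geometry (\<open>d_crossing\<close>) it lands within
  distance \<open>d a b\<close> of \<open>c'\<close>. Hence \<open>v\<close> descends from one of finitely many vertices, and
  there are only finitely many such \<open>v\<close>, uniformly in \<open>l\<close>
  (\<open>wrong_color_ancestor\<close>). This gives (a) and (b). Outside this exceptional set the
  color is that of the nearest seed, where oddness of \<open>d a b\<close> excludes ties; inside it, the
  color is inherited from earlier vertices through parents that stabilise as \<open>l\<close> grows, so it
  stabilises too (\<open>color_eventually_constant\<close>).

  Finiteness of the set of descendants. Almost surely the arrival time of \<open>u\<close> is at least
  some \<open>s\<close> for which earlier arrivals have positive probability, and every chain of ancestors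
  that ends in \<open>u\<close> has times at least \<open>s\<close>. A jump of length \<open>r\<close> in such a chain forces
  a ball of radius \<open>r - 1\<close> in the truncated tree to be free of times below \<open>s\<close>. Such a
  ball has exponentially many vertices in \<open>r\<close> (\<open>card_truncated_ball\<close>), so long jumps are
  very unlikely. The balls of different jumps overlap, but equally long jumps start from vertices that are far apart,
  because times decrease along the chain; therefore the union of the balls has more vertices than
  any fixed multiple of the total length of the long jumps
  (\<open>total_jump_le_card_explored\<close>). Short jumps cost nothing in this way. They are controlled by
  splitting the time axis into finitely many thin slices: within a slice each vertex of
  the chain contributes a small factor (\<open>prob_walk_event\<close>), so that the expected number of
  chains of total length \<open>n\<close> to a given vertex decays exponentially in \<open>n\<close>
  (\<open>finite_slice_descendants\<close>), and a chain crosses each of the finitely many slices once.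
\<close>

section \<open>Distances in trees\<close>

locale tree_graph =
  fixes E :: "'v \<Rightarrow> 'v \<Rightarrow> bool"
  assumes is_tree: "is_tree E"
begin

abbreviation d :: "'v \<Rightarrow> 'v \<Rightarrow> nat" where
  "d \<equiv> gdist E"

lemma E_sym: "E x y \<Longrightarrow> E y x"
  using is_tree by (auto simp: is_tree_def dest: sympD)

lemma E_irrefl: "\<not> E x x"
  using is_tree by (auto simp: is_tree_def dest: irreflpD)

lemma connected: "E\<^sup>*\<^sup>* x y"
  using is_tree by (auto simp: is_tree_def)

lemma relpowp_d: "(E ^^ d x y) x y"
  unfolding gdist_def by (rule LeastI_ex) (use connected[of x y] in \<open>auto simp: rtranclp_power\<close>)

lemma d_le: "(E ^^ n) x y \<Longrightarrow> d x y \<le> n"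
  unfolding gdist_def by (rule Least_le)

lemma relpowp_sym: "(E ^^ n) x y \<Longrightarrow> (E ^^ n) y x"
proof (induction n arbitrary: y)
  case (Suc n)
  then obtain z where "(E ^^ n) x z" "E z y"
    by auto
  then show ?case
    using Suc.IH[of z] E_sym relpowp_Suc_I2 by metis
qed auto

lemma d_sym: "d x y = d y x"
  by (meson antisym d_le relpowp_d relpowp_sym)

lemma d_triangle: "d x z \<le> d x y + d y z"
  by (rule d_le) (use relpowp_d[of x y] relpowp_d[of y z] in \<open>auto simp: relpowp_add\<close>)

lemma d_refl [simp]: "d x x = 0"
  using d_le[of 0 x x] by simp

lemma d_0_iff [simp]: "d x y = 0 \<longleftrightarrow> x = y"
  using relpowp_d[of x y] by auto

lemma d_pos_iff [simp]: "0 < d x y \<longleftrightarrow> x \<noteq> y"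
  using d_0_iff[of x y] by linarith

lemma d_edge_le: "E x y \<Longrightarrow> d r y \<le> Suc (d r x)"
proof -
  assume "E x y"
  then have "(E ^^ Suc (d r x)) r y"
    using relpowp_d[of r x] by auto
  then show ?thesis
    by (rule d_le)
qed

lemma step_towards:
  assumes "d r x = Suc n"
  obtains y where "E y x" "d r y = n"
proof -
  have "(E ^^ Suc n) r x"
    using relpowp_d[of r x] assms by simp
  then obtain y where y: "(E ^^ n) r y" "E y x"
    by auto
  then have "d r y \<le> n" "Suc n \<le> Suc (d r y)"
    using d_le d_edge_le[OF y(2), of r] assms by auto
  then show ?thesis
    using that y(2) by simp
qed

lemma simple_path_of_rtranclp:
  assumes "R\<^sup>*\<^sup>* x y"
  shows "\<exists>xs. xs \<noteq> [] \<and> distinct xs \<and> successively R xs \<and> hd xs = x \<and> last xs = y"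
  using assms
proof (induction rule: converse_rtranclp_induct)
  case base
  show ?case by (rule exI[of _ "[y]"]) auto
next
  case (step x z)
  then obtain xs where xs: "xs \<noteq> []" "distinct xs" "successively R xs" "hd xs = z" "last xs = y"
    by blast
  show ?case
  proof (cases "x \<in> set xs")
    case True
    then obtain us vs where "xs = us @ x # vs"
      by (meson split_list)
    then show ?thesis
      using xs by (intro exI[of _ "x # vs"]) (auto simp: successively_append_iff)
  next
    case False
    then show ?thesis
      using xs step(1) by (intro exI[of _ "x # xs"]) (cases xs; auto)
  qed
qed

text \<open>
  This is the form in which the absence of cycles is used. Geodesics from \<open>y\<close> and \<open>z\<close> to
  the root \<open>r\<close> avoid \<open>x\<close>, because the distance to the root decreases along them. If
  \<open>y \<noteq> z\<close>, their union contains a simple path from \<open>y\<close> to \<open>z\<close>, and \<open>x\<close> closes it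
  to a cycle. As \<open>y\<close> may be at the same distance from \<open>r\<close> as \<open>x\<close>, the lemma also
  forbids edges between vertices of the same level.
\<close>

lemma lower_neighbour_unique:
  assumes "E x y" "E x z" "d r y \<le> d r x" "d r z \<le> d r x"
  shows "y = z"
proof (rule ccontr)
  assume "y \<noteq> z"
  define A where "A = (\<lambda>u v. E u v \<and> u \<noteq> x \<and> v \<noteq> x)"
  have to_root: "A\<^sup>*\<^sup>* u r" if "u \<noteq> x" "d r u \<le> d r x" for u
    using that
  proof (induction "d r u" arbitrary: u)
    case 0
    then show ?case by simp
  next
    case (Suc n)
    then obtain v where v: "E v u" "d r v = n"
      using step_towards by metis
    have "v \<noteq> x"
      using Suc v by auto
    then have "A u v" "A\<^sup>*\<^sup>* v r"
      using Suc v E_sym by (auto simp: A_def)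
    then show ?case by simp
  qed
  have sym: "A\<^sup>*\<^sup>* v u" if "A\<^sup>*\<^sup>* u v" for u v
    using that
  proof induction
    case (step v w)
    then have "A w v"
      by (auto simp: A_def E_sym)
    then show ?case
      using step by simp
  qed simp
  have "y \<noteq> x" "z \<noteq> x"
    using assms E_irrefl by auto
  then have "A\<^sup>*\<^sup>* y z"
    using to_root[of y] sym[OF to_root[of z]] assms by simp
  then obtain xs where xs: "xs \<noteq> []" "distinct xs" "successively A xs" "hd xs = y" "last xs = z"
    using simple_path_of_rtranclp by metis
  have "x \<notin> set xs"
    using xs \<open>y \<noteq> x\<close>
  proof (induction xs arbitrary: y)
    case (Cons u us)
    then show ?case
      by (cases us) (auto simp: A_def)
  qed simp
  moreover have "successively E xs"
    using xs(3) by (rule successively_mono) (auto simp: A_def)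
  moreover have "length xs \<ge> 2"
    using xs \<open>y \<noteq> z\<close> by (cases xs; cases "tl xs") auto
  ultimately have "length (x # xs) \<ge> 3 \<and> distinct (x # xs) \<and> successively E (x # xs) \<and>
      E (last (x # xs)) (hd (x # xs))"
    using xs assms E_sym by (cases xs) auto
  then show False
    using is_tree unfolding is_tree_def by blast
qed

lemma d_edge_distinct: "E x y \<Longrightarrow> d r x \<noteq> d r y"
proof
  assume E: "E x y" and eq: "d r x = d r y"
  show False
  proof (cases "d r x")
    case 0
    then show False
      using eq E E_irrefl by auto
  next
    case (Suc n)
    then obtain z where "E z x" "d r z = n"
      using step_towards by metis
    then show False
      using lower_neighbour_unique[of x y z r] E eq E_sym Suc by auto
  qed
qed

lemma d_edge_cases:
  assumes "E x y"
  obtains "d r y = Suc (d r x)" | "d r x = Suc (d r y)"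
  using d_edge_le[OF assms, of r] d_edge_le[OF E_sym[OF assms], of r] d_edge_distinct[OF assms, of r]
  by linarith

text \<open>
  Trees are bipartite. For seeds at odd distance this says that no vertex is at the same
  distance from both.
\<close>

lemma parity: "even (d x y + d x z + d y z)"
proof (induction "d y z" arbitrary: z)
  case 0
  then show ?case by simp
next
  case (Suc n)
  then obtain u where u: "E u z" "d y u = n"
    using step_towards by metis
  have "even (d x y + d x u + d y u)"
    using Suc u by simp
  then show ?case
    using u Suc(2)[symmetric] by (cases rule: d_edge_cases[OF u(1), of x]) auto
qed

lemma edge_cut_unique:
  assumes "E x y" "E p q" "d p x < d p y" "d q y < d q x"
  shows "p = x \<and> q = y"
proof -
  have px: "d p y = Suc (d p x)" and qy: "d q x = Suc (d q y)"
    using assms(3,4) by (auto intro: d_edge_cases[OF assms(1), of p] d_edge_cases[OF assms(1), of q])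
  have eq: "d p x = d q y"
    using d_edge_le[OF assms(2), of x] d_edge_le[OF E_sym[OF assms(2)], of y] px qy
    by (simp add: d_sym)
  show ?thesis
  proof (cases "d q y")
    case 0
    then show ?thesis
      using eq by simp
  next
    case (Suc n)
    then have "d y q = Suc n" by (simp add: d_sym)
    then obtain q' where q': "E q' q" "d y q' = n"
      using step_towards by metis
    have "d x q' \<le> Suc n"
      using d_edge_le[OF E_sym[OF assms(1)], of q'] q' by (simp add: d_sym)
    then have "p = q'"
      using lower_neighbour_unique[of q p q' x] assms(2) q' E_sym eq qy Suc by (simp add: d_sym)
    then show ?thesis
      using px q' eq Suc by (simp add: d_sym)
  qed
qed

text \<open>
  Removing an edge disconnects the tree, so a geodesic between the two sides uses the edge.
\<close>

lemma d_across_edge: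
  assumes "E x y" "d p x < d p y" "d q y < d q x"
  shows "d p q = d p x + 1 + d y q"
  using assms(3)
proof (induction "d p q" arbitrary: q)
  case 0
  then show ?case
    using assms(2) by simp
next
  case (Suc n)
  then obtain u where u: "E u q" "d p u = n"
    using step_towards by metis
  show ?case
  proof (cases "d u y < d u x")
    case True
    have "n = d p x + 1 + d y u"
      using Suc(1)[of u] u True by simp
    moreover have "d y q \<le> Suc (d y u)"
      using d_edge_le[OF u(1)] .
    moreover have "d p q \<le> d p x + 1 + d y q"
      using d_triangle[of p q x] d_triangle[of x q y] d_edge_le[OF assms(1), of x] by simp
    ultimately show ?thesis
      using Suc(2) by simp
  next
    case False
    then have "d u x < d u y"
      using d_edge_distinct[OF assms(1), of u] by simp
    then have "u = x \<and> q = y"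
      using edge_cut_unique[OF assms(1) u(1)] Suc(3) by simp
    then show ?thesis
      using Suc(2) u by simp
  qed
qed

text \<open>
  This is the case of the four-point condition that controls how a jump leaves the half-tree
  of the seed \<open>b\<close>: it lands near \<open>b\<close> unless it is longer than the distance to \<open>b\<close>.
  A geodesic from \<open>w\<close> to \<open>u\<close> contains an edge whose ends are closer to \<open>b\<close> and to \<open>a\<close>
  respectively, and this edge separates both \<open>w\<close> from \<open>u\<close> and \<open>b\<close> from \<open>a\<close>.
\<close>

lemma d_crossing:
  assumes "odd (d a b)" "d w b < d w a" "d u a < d u b"
  shows "d w u + d a b = d w a + d u b"
proof -
  have no_tie: "d v a \<noteq> d v b" for v
  proof
    assume "d v a = d v b"
    then show False
      using parity[of v a b] assms(1) by simp
  qed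
  have "\<exists>x y. E x y \<and> d x b < d x a \<and> d y a < d y b \<and> d w x < d w y \<and> d u y < d u x"
    using assms(3)
  proof (induction "d w u" arbitrary: u)
    case 0
    then show ?case
      using assms(2) by simp
  next
    case (Suc n)
    then obtain v where v: "E v u" "d w v = n"
      using step_towards by metis
    show ?case
    proof (cases "d v a < d v b")
      case True
      then obtain x y where xy: "E x y" "d x b < d x a" "d y a < d y b" "d w x < d w y" "d v y < d v x"
        using Suc(1) v by blast
      have "d u y < d u x"
      proof (rule ccontr)
        assume "\<not> d u y < d u x"
        then have "d u x < d u y"
          using d_edge_distinct[OF xy(1), of u] by simp
        then have "u = x \<and> v = y"
          using edge_cut_unique[OF xy(1) E_sym[OF v(1)]] xy(5) by simp
        then show False
          using xy Suc by simp
      qed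
      then show ?thesis
        using xy by blast
    next
      case False
      then have "d v b < d v a"
        using no_tie[of v] by simp
      moreover have "d w v < d w u"
        using v Suc by simp
      moreover have "u \<noteq> v"
        using v(1) E_irrefl by auto
      ultimately show ?thesis
        using v Suc(3) by (intro exI[of _ v] exI[of _ u]) auto
    qed
  qed
  then obtain x y where xy: "E x y" "d x b < d x a" "d y a < d y b" "d w x < d w y" "d u y < d u x"
    by blast
  have 1: "d a x \<le> Suc (d a y)" "d b y \<le> Suc (d b x)" "d a x > d b x" "d b y > d a y"
    using d_edge_le[OF xy(1), of b] d_edge_le[OF E_sym[OF xy(1)], of a] xy by (simp_all add: d_sym)
  then have "d a y < d a x" "d b x < d b y"
    by linarith+
  then show ?thesis
    using d_across_edge[OF xy(1), of w u] d_across_edge[OF xy(1), of b a]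
      d_across_edge[OF xy(1), of w a] d_across_edge[OF xy(1), of b u] xy
    by (simp add: d_sym)
qed

end

section \<open>Growth of balls\<close>

locale regular_tree_graph = tree_graph E
  for E :: "'v \<Rightarrow> 'v \<Rightarrow> bool" +
  fixes K :: nat
  assumes K_ge_2: "K \<ge> 2"
    and degree: "finite {u. E v u}" "card {u. E v u} = K + 1"
begin

lemma sphere_bound: "finite {u. d v u = n}" "card {u. d v u = n} \<le> (K + 1) ^ n"
proof (induction n)
  case 0
  have "{u. d v u = 0} = {v}"
    by auto
  then show "finite {u. d v u = 0}" "card {u. d v u = 0} \<le> (K + 1) ^ 0"
    by auto
next
  case (Suc n)
  have sub: "{u. d v u = Suc n} \<subseteq> (\<Union>x\<in>{u. d v u = n}. {u. E x u})"
  proof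
    fix u assume "u \<in> {u. d v u = Suc n}"
    then obtain x where "E x u" "d v x = n"
      using step_towards[of v u n] by auto
    then show "u \<in> (\<Union>x\<in>{u. d v u = n}. {u. E x u})"
      by auto
  qed
  have fin: "finite (\<Union>x\<in>{u. d v u = n}. {u. E x u})"
    using Suc(1) degree(1) by auto
  have "card (\<Union>x\<in>{u. d v u = n}. {u. E x u}) \<le> (\<Sum>x\<in>{u. d v u = n}. card {u. E x u})"
    by (rule card_UN_le) (rule Suc(1))
  also have "\<dots> = card {u. d v u = n} * (K + 1)"
    using degree(2) by simp
  also have "\<dots> \<le> (K + 1) ^ n * (K + 1)"
    by (rule mult_right_mono) (use Suc(2) in auto)
  finally show "card {u. d v u = Suc n} \<le> (K + 1) ^ Suc n"
    using card_mono[OF fin sub] by (simp add: mult.commute)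
  show "finite {u. d v u = Suc n}"
    using finite_subset[OF sub fin] .
qed

lemma finite_ball: "finite {u. d v u \<le> n}"
proof -
  have "{u. d v u \<le> n} = (\<Union>i\<le>n. {u. d v u = i})"
    by auto
  then show ?thesis
    using sphere_bound(1) by auto
qed

lemma countable_vertices: "countable (UNIV :: 'v set)"
proof -
  have "(UNIV :: 'v set) = (\<Union>n. {u. d undefined u \<le> n})"
    by auto
  also have "countable \<dots>"
    using finite_ball by (intro countable_UN) (auto intro: countable_finite)
  finally show ?thesis .
qed

text \<open>
  At most one of the \<open>K + 1\<close> neighbours of \<open>y\<close> is closer to \<open>r\<close>, which leaves at
  least \<open>K \<ge> 2\<close> children. Two children already give exponential growth.
\<close>

lemma two_le_card_children:
  "finite {x. E y x \<and> d r x = Suc (d r y)}" "2 \<le> card {x. E y x \<and> d r x = Suc (d r y)}"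
proof -
  let ?P = "{x. E y x \<and> d r y = Suc (d r x)}" and ?C = "{x. E y x \<and> d r x = Suc (d r y)}"
  have eq: "{x. E y x} = ?P \<union> ?C"
    by (auto elim: d_edge_cases[of y _ r])
  have fin: "finite ?P" "finite ?C"
    using degree(1)[of y] unfolding eq by auto
  then show "finite ?C"
    by simp
  have "card ?P \<le> 1"
  proof (cases "?P = {}")
    case True
    then show ?thesis
      by (simp only: card.empty)
  next
    case False
    then obtain p where p: "p \<in> ?P"
      by blast
    have "?P \<subseteq> {p}"
      using p lower_neighbour_unique[of y _ p r] by auto
    then show ?thesis
      using card_mono[of "{p}" ?P] by simp
  qed
  moreover have "K + 1 \<le> card ?P + card ?C"
    using degree(2)[of y] card_Un_le[of ?P ?C] unfolding eq by simp
  ultimately show "2 \<le> card ?C"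
    using K_ge_2 by simp
qed

lemma card_descendants:
  "2 ^ h \<le> card {x. d y x \<le> h \<and> d r x = d r y + h}"
proof (induction h)
  case 0
  have "{x. d y x \<le> 0 \<and> d r x = d r y + 0} = {y}"
    by auto
  then show ?case
    by simp
next
  case (Suc h)
  let ?S = "\<lambda>h. {x. d y x \<le> h \<and> d r x = d r y + h}"
  let ?C = "\<lambda>z. {x. E z x \<and> d r x = Suc (d r z)}"
  have fin: "finite (?S h)" for h
    using finite_ball[of y h] by (rule rev_finite_subset) auto
  have sub: "(\<Union>z\<in>?S h. ?C z) \<subseteq> ?S (Suc h)"
    by (auto intro: order_trans[OF d_edge_le])
  have disj: "?C z \<inter> ?C z' = {}" if "z \<noteq> z'" for z z'
  proof (rule ccontr)
    assume "?C z \<inter> ?C z' \<noteq> {}"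
    then obtain x where "E z x" "d r x = Suc (d r z)" "E z' x" "d r x = Suc (d r z')"
      by auto
    then show False
      using that lower_neighbour_unique[of x z z' r] E_sym by simp
  qed
  have "2 ^ Suc h \<le> (\<Sum>z\<in>?S h. 2 :: nat)"
    using Suc by simp
  also have "\<dots> \<le> (\<Sum>z\<in>?S h. card (?C z))"
    by (rule sum_mono) (rule two_le_card_children(2))
  also have "\<dots> = card (\<Union>z\<in>?S h. ?C z)"
    by (rule card_UN_disjoint[symmetric]) (use fin two_le_card_children(1) disj in blast)+
  also have "\<dots> \<le> card (?S (Suc h))"
    by (rule card_mono[OF fin sub])
  finally show ?case .
qed

lemma ancestor_exists:
  assumes "h \<le> d r v"
  shows "\<exists>y. d v y \<le> h \<and> d r v = d r y + h"
  using assms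
proof (induction h)
  case 0
  then show ?case
    by (intro exI[of _ v]) simp
next
  case (Suc h)
  then obtain y where y: "d v y \<le> h" "d r v = d r y + h"
    by auto
  then have "d r y = Suc (d r y - 1)"
    using Suc by simp
  then obtain x where x: "E x y" "d r x = d r y - 1"
    using step_towards by metis
  have "d v x \<le> Suc h"
    using d_edge_le[OF E_sym[OF x(1)], of v] y by simp
  then show ?case
    using x y Suc by (intro exI[of _ x]) simp
qed

text \<open>
  Truncating the tree at the level of \<open>v\<close> can leave only one direction to move away from
  \<open>v\<close>, upwards. Half of the radius is spent on reaching an ancestor and the other half on its
  descendants, so the volume growth is still exponential.
\<close>

lemma card_truncated_ball:
  assumes "h \<le> d r v"
  shows "2 ^ h \<le> card {x. d v x \<le> 2 * h \<and> d r x \<le> d r v}"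
proof -
  obtain y where y: "d v y \<le> h" "d r v = d r y + h"
    using ancestor_exists[OF assms] by auto
  have "2 ^ h \<le> card {x. d y x \<le> h \<and> d r x = d r y + h}"
    by (rule card_descendants)
  also have "\<dots> \<le> card {x. d v x \<le> 2 * h \<and> d r x \<le> d r v}"
  proof (rule card_mono)
    show "finite {x. d v x \<le> 2 * h \<and> d r x \<le> d r v}"
      using finite_ball[of v "2 * h"] by (rule rev_finite_subset) auto
    show "{x. d y x \<le> h \<and> d r x = d r y + h} \<subseteq> {x. d v x \<le> 2 * h \<and> d r x \<le> d r v}"
      using y by (auto intro: order_trans[OF d_triangle[of v _ y]])
  qed
  finally show ?thesis .
qed

end

section \<open>Long jumps are expensive\<close>

text \<open>
  The exponent \<open>(r - 1) div 4\<close> is the one of the volume bound for the balls of radius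
  \<open>(r - 1) / 2\<close> in a truncated tree. The factor \<open>r\<close> will be the length of a jump and
  \<open>M\<close> the cost that is demanded per unit of length: beyond \<open>R\<close>, volumes exceed any fixed
  multiple of the lengths, even after summation over the lengths.
\<close>

lemma small_tail:
  fixes M :: nat
  obtains R :: nat where "\<And>n. (\<Sum>r=R..n. M * r / 2 ^ ((r - 1) div 4) :: real) \<le> 1"
proof -
  let ?f = "\<lambda>r::nat. M * r / 2 ^ ((r - 1) div 4) :: real"
  define z :: real where "z = 2 powr (- 1 / 4)"
  have "norm z < 1"
    by (simp add: z_def powr_less_one)
  then have summable: "summable (\<lambda>r. of_nat (Suc r) * z ^ r)"
    by (rule sums_summable[OF geometric_deriv_sums])
  have bound: "norm (?f r) \<le> 2 * M * (of_nat (Suc r) * z ^ r)" for r :: nat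
  proof -
    have "r \<le> 4 * ((r - 1) div 4) + 4"
      by linarith
    then have "real r / 4 \<le> real ((r - 1) div 4) + 1"
      by linarith
    then have "2 powr (r / 4) \<le> 2 powr (real ((r - 1) div 4) + 1)"
      by simp
    also have "\<dots> = 2 * 2 ^ ((r - 1) div 4)"
      by (simp add: powr_add powr_realpow)
    finally have "1 / (2 * 2 ^ ((r - 1) div 4)) \<le> 1 / (2 powr (real r / 4))"
      by (intro divide_left_mono) auto
    then have "2 * (real M * real r) * (1 / (2 * 2 ^ ((r - 1) div 4)))
        \<le> 2 * (real M * real r) * (1 / (2 powr (real r / 4)))"
      by (intro mult_left_mono) auto
    also have "1 / (2 powr (real r / 4)) = z ^ r"
      unfolding z_def by (subst powr_power) (simp_all add: powr_minus_divide)
    also have "2 * (real M * real r) * z ^ r \<le> 2 * (real M * real (Suc r)) * z ^ r"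
      by (intro mult_right_mono) (auto simp: z_def mult_left_mono)
    finally show ?thesis
      by (simp add: mult_ac)
  qed
  have "summable ?f"
    by (rule summable_comparison_test'[OF summable_mult[OF summable] bound])
  then obtain R where R: "\<And>m n. m \<ge> R \<Longrightarrow> norm (sum ?f {m..<n}) < 1"
    unfolding summable_Cauchy by (meson zero_less_one)
  show ?thesis
  proof (rule that)
    fix n
    show "sum ?f {R..n} \<le> 1"
      using R[of R "Suc n"] by (simp add: atLeastLessThanSuc_atLeastAtMost)
  qed
qed

context regular_tree_graph
begin

text \<open>
  A list \<open>xs\<close> read from a start \<open>w\<close> stands for a path of ancestors run backwards: each
  entry of \<open>w # xs\<close> is the parent of the next one. Hence \<open>jump w xs j\<close> is the distance
  from \<open>xs ! j\<close> to its parent.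
\<close>

definition jump :: "'v \<Rightarrow> 'v list \<Rightarrow> nat \<Rightarrow> nat" where
  "jump w xs j = d (xs ! j) ((w # xs) ! j)"

definition total_jump :: "'v \<Rightarrow> 'v list \<Rightarrow> nat" where
  "total_jump w xs = (\<Sum>j<length xs. jump w xs j)"

text \<open>
  These are the vertices, in the tree truncated at level \<open>l\<close> around \<open>r\<close>, that are closer
  to some \<open>xs ! j\<close> than its parent is. The choice of this parent means that none of them has
  arrived before \<open>xs ! j\<close>.
\<close>

definition explored :: "'v \<Rightarrow> nat \<Rightarrow> 'v \<Rightarrow> 'v list \<Rightarrow> 'v set" where
  "explored r l w xs = {y. d r y \<le> l \<and> (\<exists>j<length xs. d (xs ! j) y < jump w xs j)}"

lemma finite_explored: "finite (explored r l w xs)"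
  by (rule finite_subset[OF _ finite_ball[of r l]]) (auto simp: explored_def)

text \<open>
  Starting points of jumps of the same length \<open>n\<close> are at distance at least \<open>n\<close> from each
  other, so the balls around them of radius below \<open>n / 2\<close> are disjoint. Each of these balls
  is explored, and it is exponentially large in \<open>n\<close> even after truncation.
\<close>

lemma card_jumps_eq:
  assumes level: "\<And>j. j < length xs \<Longrightarrow> d r (xs ! j) \<le> l"
    and apart: "\<And>i j. i < j \<Longrightarrow> j < length xs \<Longrightarrow> jump w xs j \<le> d (xs ! j) (xs ! i)"
    and root: "r \<notin> explored r l w xs"
    and n: "0 < n"
  shows "card {j. j < length xs \<and> jump w xs j = n} * 2 ^ ((n - 1) div 4)
    \<le> card (explored r l w xs)"
proof -
  define h where "h = (n - 1) div 4"
  define J where "J = {j. j < length xs \<and> jump w xs j = n}"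
  define A where "A = (\<lambda>j. {x. d (xs ! j) x \<le> 2 * h \<and> d r x \<le> d r (xs ! j)})"
  \<comment> \<open>Two balls of radius \<open>2 * h\<close> can only meet if their centres are at distance at most \<open>4 * h\<close>.\<close>
  have h: "4 * h < n"
    using n unfolding h_def by linarith
  have "card J * 2 ^ h = (\<Sum>j\<in>J. 2 ^ h)"
    by simp
  also have "\<dots> \<le> (\<Sum>j\<in>J. card (A j))"
  proof (rule sum_mono)
    fix j assume j: "j \<in> J"
    \<comment> \<open>The root is not explored, so the jump is not longer than the distance to the root.\<close>
    have "n \<le> d (xs ! j) r"
      using root j by (force simp: explored_def J_def)
    then show "2 ^ h \<le> card (A j)"
      unfolding A_def using h by (intro card_truncated_ball) (simp add: d_sym)
  qed
  also have "\<dots> = card (\<Union>j\<in>J. A j)"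
  proof (rule card_UN_disjoint[symmetric])
    show "finite J"
      by (simp add: J_def)
    show "\<forall>j\<in>J. finite (A j)"
      unfolding A_def by (auto intro: finite_subset[OF _ finite_ball])
    have "A i \<inter> A j = {}" if "i \<in> J" "j \<in> J" "i < j" for i j
    proof (rule ccontr)
      assume "A i \<inter> A j \<noteq> {}"
      then obtain x where "d (xs ! i) x \<le> 2 * h" "d (xs ! j) x \<le> 2 * h"
        by (auto simp: A_def)
      then have "d (xs ! j) (xs ! i) \<le> 4 * h"
        using d_triangle[of "xs ! j" "xs ! i" x] by (simp add: d_sym)
      then show False
        using apart[of i j] that h by (simp add: J_def)
    qed
    then show "\<forall>i\<in>J. \<forall>j\<in>J. i \<noteq> j \<longrightarrow> A i \<inter> A j = {}"
      by (metis Int_commute linorder_neqE_nat)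
  qed
  also have "\<dots> \<le> card (explored r l w xs)"
    using level h by (intro card_mono finite_explored) (force simp: A_def J_def explored_def)
  finally show ?thesis
    by (simp add: h_def J_def)
qed

text \<open>
  The sets explored by the single jumps overlap, so their sizes cannot simply be added. Grouping
  the jumps by length avoids this: by the previous lemma there are few jumps of each length
  \<open>n\<close> compared with the total explored volume, so few that the lengths of all jumps of
  length at least \<open>R\<close> add up to a small fraction of this volume. Shorter jumps are charged
  to the number of jumps.
\<close>

lemma total_jump_le_card_explored:
  fixes M R :: nat
  assumes level: "\<And>j. j < length xs \<Longrightarrow> d r (xs ! j) \<le> l"
    and apart: "\<And>i j. i < j \<Longrightarrow> j < length xs \<Longrightarrow> jump w xs j \<le> d (xs ! j) (xs ! i)"
    and root: "r \<notin> explored r l w xs"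
    and tail: "\<And>n. (\<Sum>r=R..n. M * r / 2 ^ ((r - 1) div 4) :: real) \<le> 1"
  shows "M * total_jump w xs \<le> card (explored r l w xs) + M * R * length xs"
proof -
  let ?J = "\<lambda>n. {j. j < length xs \<and> jump w xs j = n}"
  define V where "V = card (explored r l w xs)"
  define n where "n = total_jump w xs"
  define S where "S = (\<Sum>j\<in>{j. j < length xs \<and> R \<le> jump w xs j}. jump w xs j)"
  have le_n: "jump w xs j \<le> n" if "j < length xs" for j
    unfolding n_def total_jump_def using that by (intro member_le_sum) auto
  have split: "{..<length xs} = {j. j < length xs \<and> jump w xs j < R} \<union> {j. j < length xs \<and> R \<le> jump w xs j}"
    by auto
  have "total_jump w xs = (\<Sum>j\<in>{j. j < length xs \<and> jump w xs j < R}. jump w xs j) + S"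
    unfolding total_jump_def S_def split by (rule sum.union_disjoint) auto
  also have "(\<Sum>j\<in>{j. j < length xs \<and> jump w xs j < R}. jump w xs j)
      \<le> (\<Sum>j\<in>{j. j < length xs \<and> jump w xs j < R}. R)"
    by (rule sum_mono) auto
  also have "\<dots> \<le> R * length xs"
    using card_mono[of "{..<length xs}" "{j. j < length xs \<and> jump w xs j < R}"] by auto
  finally have total: "total_jump w xs \<le> R * length xs + S"
    by simp
  have "S = (\<Sum>k\<in>{R..n}. \<Sum>j\<in>{j \<in> {j. j < length xs \<and> R \<le> jump w xs j}. jump w xs j = k}. jump w xs j)"
    unfolding S_def using le_n by (intro sum.group[symmetric]) auto
  also have "\<dots> = (\<Sum>k\<in>{R..n}. \<Sum>j\<in>?J k. k)"
    by (intro sum.cong) auto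
  finally have "real (M * S) = (\<Sum>k=R..n. real M * k * card (?J k))"
    by (simp add: sum_distrib_left mult_ac)
  also have "\<dots> \<le> (\<Sum>k=R..n. (M * k / 2 ^ ((k - 1) div 4)) * V)"
  proof (rule sum_mono)
    fix k
    show "real M * k * card (?J k) \<le> (M * k / 2 ^ ((k - 1) div 4)) * V"
    proof (cases "k = 0")
      case False
      then have "card (?J k) * 2 ^ ((k - 1) div 4) \<le> V"
        unfolding V_def using level apart root by (intro card_jumps_eq) auto
      then have "real (card (?J k) * 2 ^ ((k - 1) div 4)) \<le> real V"
        by (rule of_nat_mono)
      then have "real (card (?J k)) * 2 ^ ((k - 1) div 4) \<le> real V"
        by simp
      then have "real (card (?J k)) \<le> V / 2 ^ ((k - 1) div 4)"
        by (simp add: field_simps)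
      then have "(real M * k) * card (?J k) \<le> (real M * k) * (V / 2 ^ ((k - 1) div 4))"
        by (intro mult_left_mono) auto
      then show ?thesis
        by (simp add: field_simps)
    qed simp
  qed
  also have "\<dots> = (\<Sum>k=R..n. M * k / 2 ^ ((k - 1) div 4)) * V"
    by (simp add: sum_distrib_right)
  also have "\<dots> \<le> 1 * real V"
    by (rule mult_right_mono) (use tail in auto)
  finally have "M * S \<le> V"
    by (simp only: mult_1 of_nat_le_iff)
  moreover have "M * total_jump w xs \<le> M * R * length xs + M * S"
    using mult_le_mono2[OF total, of M] by (simp add: algebra_simps)
  ultimately show ?thesis
    by (simp add: V_def)
qed

definition walks :: "'v \<Rightarrow> nat \<Rightarrow> 'v list set" where
  "walks w n = {xs. (\<forall>j<length xs. 0 < jump w xs j) \<and> total_jump w xs = n}"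

lemma total_jump_Cons: "total_jump w (x # xs) = d w x + total_jump x xs"
  unfolding total_jump_def jump_def by (simp only: length_Cons sum.lessThan_Suc_shift) (simp add: d_sym)

lemma jump_Cons_Suc: "jump w (x # xs) (Suc j) = jump x xs j"
  by (simp add: jump_def)

lemma walks_0: "walks w 0 = {[]}"
proof -
  have "xs = []" if "xs \<in> walks w 0" for xs
    using that by (cases xs) (auto simp: walks_def total_jump_def)
  moreover have "[] \<in> walks w 0"
    by (simp add: walks_def total_jump_def)
  ultimately show ?thesis
    by blast
qed

lemma walks_subset:
  assumes "n > 0"
  shows "walks w n \<subseteq> (\<Union>k\<in>{1..n}. \<Union>x\<in>{x. d w x = k}. (#) x ` walks x (n - k))"
proof
  fix xs assume xs: "xs \<in> walks w n"
  then obtain x ys where [simp]: "xs = x # ys"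
    using assms by (cases xs) (auto simp: walks_def total_jump_def)
  have "jump w xs 0 > 0"
    using xs by (auto simp: walks_def)
  then have "w \<noteq> x"
    by (auto simp: jump_def)
  moreover have "0 < jump x ys j" if "j < length ys" for j
    using xs that jump_Cons_Suc[of w x ys j] by (auto simp: walks_def)
  then have "ys \<in> walks x (n - d w x)" "d w x \<le> n"
    using xs by (auto simp: walks_def total_jump_Cons)
  ultimately show "xs \<in> (\<Union>k\<in>{1..n}. \<Union>x\<in>{x. d w x = k}. (#) x ` walks x (n - k))"
    by (intro UN_I[of "d w x"] UN_I[of x]) (simp_all add: Suc_le_eq)
qed

text \<open>
  A walk of total length \<open>n\<close> is given by a composition of \<open>n\<close> and a choice of a point on
  a sphere for each part, which gives at most \<open>2 ^ n * (K + 1) ^ n\<close> walks.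
\<close>

lemma finite_card_walks: "finite (walks w n) \<and> card (walks w n) \<le> (2 * (K + 1)) ^ n"
proof (induction n arbitrary: w rule: less_induct)
  case (less n)
  have fin: "finite (walks x m)" and bound: "card (walks x m) \<le> (2 * (K + 1)) ^ m" if "m < n" for x m
    using less.IH[OF that] by (rule conjunct1, rule conjunct2)
  let ?Y = "\<lambda>k. \<Union>x\<in>{x. d w x = k}. (#) x ` walks x (n - k)"
  have "finite (walks w n)"
  proof (cases "n = 0")
    case True
    then show ?thesis
      by (simp add: walks_0)
  next
    case False
    then show ?thesis
      using fin sphere_bound(1) by (intro finite_subset[OF walks_subset]) auto
  qed
  moreover have "card (walks w n) \<le> (2 * (K + 1)) ^ n"
  proof (cases "n = 0")
    case True
    then show ?thesis
      by (simp add: walks_0)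
  next
    case False
    have finY: "finite (?Y k)" if "k \<in> {1..n}" for k
      using fin sphere_bound(1) that by auto
    have cardY: "card (?Y k) \<le> (K + 1) ^ n * 2 ^ (n - k)" if k: "k \<in> {1..n}" for k
    proof -
      have "card (?Y k) \<le> (\<Sum>x\<in>{x. d w x = k}. card ((#) x ` walks x (n - k)))"
        by (rule card_UN_le) (rule sphere_bound)
      also have "\<dots> \<le> (\<Sum>x\<in>{x. d w x = k}. (2 * (K + 1)) ^ (n - k))"
      proof (rule sum_mono)
        fix x
        have "card ((#) x ` walks x (n - k)) \<le> card (walks x (n - k))"
          by (rule card_image_le) (use fin k in auto)
        also have "\<dots> \<le> (2 * (K + 1)) ^ (n - k)"
          using bound k by simp
        finally show "card ((#) x ` walks x (n - k)) \<le> (2 * (K + 1)) ^ (n - k)" .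
      qed
      also have "\<dots> = card {x. d w x = k} * (2 * (K + 1)) ^ (n - k)"
        by simp
      also have "\<dots> \<le> (K + 1) ^ k * (2 * (K + 1)) ^ (n - k)"
        by (rule mult_right_mono) (use sphere_bound(2) in auto)
      also have "\<dots> = (K + 1) ^ (k + (n - k)) * 2 ^ (n - k)"
        by (simp only: power_mult_distrib power_add mult_ac)
      also have "k + (n - k) = n"
        using k by simp
      finally show ?thesis .
    qed
    have "card (walks w n) \<le> card (\<Union>k\<in>{1..n}. ?Y k)"
      using False finY by (intro card_mono walks_subset finite_UN_I[OF finite_atLeastAtMost]) simp_all
    also have "\<dots> \<le> (\<Sum>k\<in>{1..n}. card (?Y k))"
      by (rule card_UN_le) simp
    also have "\<dots> \<le> (\<Sum>k\<in>{1..n}. (K + 1) ^ n * 2 ^ (n - k))"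
      by (rule sum_mono) (rule cardY)
    also have "\<dots> = (K + 1) ^ n * (\<Sum>k\<in>{1..n}. 2 ^ (n - k))"
      by (simp add: sum_distrib_left)
    also have "(\<Sum>k\<in>{1..n}. 2 ^ (n - k)) = (\<Sum>k<n. 2 ^ k :: nat)"
      by (rule sum.reindex_bij_witness[of _ "\<lambda>k. n - k" "\<lambda>k. n - k"]) auto
    also have "\<dots> \<le> 2 ^ n"
      by (simp add: sum_power2 lessThan_atLeast0)
    finally have "card (walks w n) \<le> (K + 1) ^ n * 2 ^ n"
      by simp
    also have "\<dots> = (2 * (K + 1)) ^ n"
      by (simp only: power_mult_distrib mult.commute)
    finally show ?thesis .
  qed
  ultimately show ?case ..
qed

lemmas finite_walks = finite_card_walks[THEN conjunct1]
  and card_walks = finite_card_walks[THEN conjunct2]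

end

section \<open>Descendants\<close>

text \<open>
  What remains of the parent map after the order of equidistant vertices is forgotten:
  \<open>w\<close> has arrived before \<open>v\<close> and no vertex that is strictly closer to \<open>v\<close> has, in the
  tree truncated at level \<open>l\<close>.
\<close>

definition candidate_parent ::
    "('v \<Rightarrow> 'v \<Rightarrow> bool) \<Rightarrow> 'v \<Rightarrow> nat \<Rightarrow> ('v \<Rightarrow> real) \<Rightarrow> 'v \<Rightarrow> 'v \<Rightarrow> bool" where
  "candidate_parent E a l t v w \<longleftrightarrow> gdist E a v \<le> l \<and> gdist E a w \<le> l \<and> t w < t v \<and>
     (\<forall>x. gdist E a x \<le> l \<and> gdist E v x < gdist E v w \<longrightarrow> t v \<le> t x)"

text \<open>
  The set \<open>J\<close> constrains the arrival times of all vertices of a chain but the last one, so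
  that chains with different sets \<open>J\<close> can be joined.
\<close>

definition chain_rel ::
    "('v \<Rightarrow> 'v \<Rightarrow> bool) \<Rightarrow> 'v \<Rightarrow> nat \<Rightarrow> ('v \<Rightarrow> real) \<Rightarrow> real set \<Rightarrow> 'v \<Rightarrow> 'v \<Rightarrow> bool" where
  "chain_rel E a l t J v w \<longleftrightarrow> candidate_parent E a l t v w \<and> t v \<in> J"

text \<open>
  The union over all truncation levels \<open>l\<close> makes a finiteness statement about descendants
  uniform in \<open>l\<close>.
\<close>

definition descendants ::
    "('v \<Rightarrow> 'v \<Rightarrow> bool) \<Rightarrow> 'v \<Rightarrow> ('v \<Rightarrow> real) \<Rightarrow> real set \<Rightarrow> 'v \<Rightarrow> 'v set" where
  "descendants E a t J w = {v. \<exists>l. (chain_rel E a l t J)\<^sup>*\<^sup>* v w}"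

lemma chain_list:
  assumes "R\<^sup>*\<^sup>* v w"
  shows "\<exists>xs. last (w # xs) = v \<and> (\<forall>j<length xs. R (xs ! j) ((w # xs) ! j))"
  using assms
proof (induction rule: rtranclp_induct)
  case base
  show ?case
    by (intro exI[of _ "[]"]) simp
next
  case (step w w')
  then obtain xs where xs: "last (w # xs) = v" "\<And>j. j < length xs \<Longrightarrow> R (xs ! j) ((w # xs) ! j)"
    by blast
  have "R ((w # xs) ! j) ((w' # w # xs) ! j)" if "j < length (w # xs)" for j
    using that xs(2) step(2) by (cases j) auto
  then show ?case
    using xs(1) by (intro exI[of _ "w # xs"]) simp
qed

text \<open>
  Arrival times decrease along a chain. So if \<open>U\<close> is closed downwards, the chain stays in
  \<open>U\<close> once it has entered it.
\<close>

lemma chain_split: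
  fixes U :: "real set"
  assumes down: "\<And>x y. x < y \<Longrightarrow> y \<in> U \<Longrightarrow> x \<in> U"
    and "(chain_rel E a l t J)\<^sup>*\<^sup>* v w"
  shows "\<exists>x. (chain_rel E a l t (J - U))\<^sup>*\<^sup>* v x \<and> (chain_rel E a l t (J \<inter> U))\<^sup>*\<^sup>* x w"
  using assms(2)
proof (induction rule: converse_rtranclp_induct)
  case base
  show ?case
    by blast
next
  case (step v v')
  then obtain x where x: "(chain_rel E a l t (J - U))\<^sup>*\<^sup>* v' x" "(chain_rel E a l t (J \<inter> U))\<^sup>*\<^sup>* x w"
    by blast
  show ?case
  proof (cases "t v \<in> U")
    case True
    then have "t v' \<in> U"
      using down[of "t v'" "t v"] step(1) by (auto simp: chain_rel_def candidate_parent_def)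
    then have "x = v'"
      using x(1) by (auto simp: chain_rel_def elim: converse_rtranclpE)
    moreover have "chain_rel E a l t (J \<inter> U) v v'"
      using step(1) True by (simp add: chain_rel_def)
    ultimately have "(chain_rel E a l t (J \<inter> U))\<^sup>*\<^sup>* v w"
      using x(2) by simp
    then show ?thesis
      by blast
  next
    case False
    then have "chain_rel E a l t (J - U) v v'"
      using step(1) by (simp add: chain_rel_def)
    then have "(chain_rel E a l t (J - U))\<^sup>*\<^sup>* v x"
      using x(1) by simp
    then show ?thesis
      using x(2) by blast
  qed
qed

lemma descendants_split:
  assumes "\<And>x y. x < y \<Longrightarrow> y \<in> U \<Longrightarrow> x \<in> U"
  shows "descendants E a t J w \<subseteq> (\<Union>x\<in>descendants E a t (J \<inter> U) w. descendants E a t (J - U) x)"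
proof
  fix v assume "v \<in> descendants E a t J w"
  then obtain l where "(chain_rel E a l t J)\<^sup>*\<^sup>* v w"
    by (auto simp: descendants_def)
  then have "\<exists>x. (chain_rel E a l t (J - U))\<^sup>*\<^sup>* v x \<and> (chain_rel E a l t (J \<inter> U))\<^sup>*\<^sup>* x w"
    by (rule chain_split[rotated]) (rule assms)
  then obtain x
    where "(chain_rel E a l t (J - U))\<^sup>*\<^sup>* v x" "(chain_rel E a l t (J \<inter> U))\<^sup>*\<^sup>* x w"
    by auto
  then have "v \<in> descendants E a t (J - U) x" "x \<in> descendants E a t (J \<inter> U) w"
    by (auto simp: descendants_def)
  then show "v \<in> (\<Union>x\<in>descendants E a t (J \<inter> U) w. descendants E a t (J - U) x)"
    by (rule UN_I[rotated])
qed

context regular_tree_graph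
begin

text \<open>
  The level at which the explored set is truncated must be a function of the list, because a
  probability will be assigned to each list, whereas the chain may live in any truncated tree
  that contains it. The highest level of an entry of the list is the largest level up to which
  every such tree is complete. (For the empty list nothing is explored, whatever the value of
  \<open>Max {}\<close>.)
\<close>

lemma chain_walk:
  assumes "(chain_rel E r l t J)\<^sup>*\<^sup>* v w"
  obtains xs where "last (w # xs) = v"
    and "\<And>j. j < length xs \<Longrightarrow> 0 < jump w xs j"
    and "\<And>i j. i < j \<Longrightarrow> j < length xs \<Longrightarrow> jump w xs j \<le> d (xs ! j) (xs ! i)"
    and "\<And>x. x \<in> set xs \<Longrightarrow> t x \<in> J"
    and "\<And>y. y \<in> explored r (Max (d r ` set xs)) w xs \<Longrightarrow> \<exists>x\<in>set xs. t x \<le> t y"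
proof -
  obtain xs where xs: "last (w # xs) = v"
    and chain: "\<And>j. j < length xs \<Longrightarrow> chain_rel E r l t J (xs ! j) ((w # xs) ! j)"
    using chain_list[OF assms] by blast
  have level: "d r (xs ! j) \<le> l" if "j < length xs" for j
    using chain[OF that] by (simp add: chain_rel_def candidate_parent_def)
  have later: "t (xs ! j) \<le> t y" if "j < length xs" "d r y \<le> l" "d (xs ! j) y < jump w xs j" for j y
    using chain[OF that(1)] that by (simp add: chain_rel_def candidate_parent_def jump_def)
  have mono: "t (xs ! i) < t (xs ! j)" if "i < j" "j < length xs" for i j
    using that
  proof (induction j)
    case (Suc j)
    have "t (xs ! j) < t (xs ! Suc j)"
      using chain[of "Suc j"] Suc.prems by (simp add: chain_rel_def candidate_parent_def)
    then show ?case
      using Suc by (cases "i = j") auto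
  qed simp
  show ?thesis
  proof (rule that[OF xs])
    fix j assume j: "j < length xs"
    have "t ((w # xs) ! j) < t (xs ! j)"
      using chain[OF j] by (simp add: chain_rel_def candidate_parent_def)
    then show "0 < jump w xs j"
      by (auto simp: jump_def)
  next
    fix i j assume "i < j" "j < length xs"
    then show "jump w xs j \<le> d (xs ! j) (xs ! i)"
      using mono[of i j] later[of j "xs ! i"] level[of i] by linarith
  next
    fix x assume "x \<in> set xs"
    then show "t x \<in> J"
      using chain by (auto simp: in_set_conv_nth chain_rel_def)
  next
    fix y assume y: "y \<in> explored r (Max (d r ` set xs)) w xs"
    then obtain j where j: "j < length xs" "d (xs ! j) y < jump w xs j"
      by (auto simp: explored_def)
    have "Max (d r ` set xs) \<le> l"
      using level j(1) by (subst Max_le_iff) (auto simp: in_set_conv_nth)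
    then have "d r y \<le> l"
      using y by (simp add: explored_def)
    then show "\<exists>x\<in>set xs. t x \<le> t y"
      using later j by (intro bexI[of _ "xs ! j"]) auto
  qed
qed

end

section \<open>Finiteness of the set of descendants\<close>

locale arrival_times = regular_tree_graph E K + prob_space M
  for E :: "'v \<Rightarrow> 'v \<Rightarrow> bool" and K :: nat and M :: "'w measure" +
  fixes a b :: 'v and \<mu> :: "real measure" and \<tau> :: "'v \<Rightarrow> 'w \<Rightarrow> real"
  assumes \<mu>_pos: "AE x in \<mu>. x > 0"
    and \<mu>_atomless: "emeasure \<mu> {x} = 0"
    and \<tau>_measurable: "v \<notin> {a, b} \<Longrightarrow> \<tau> v \<in> borel_measurable M"
    and \<tau>_distr: "v \<notin> {a, b} \<Longrightarrow> distr M borel (\<tau> v) = \<mu>"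
    and \<tau>_seed: "v \<in> {a, b} \<Longrightarrow> \<omega> \<in> space M \<Longrightarrow> \<tau> v \<omega> = 0"
    and \<tau>_indep: "indep_sets (\<lambda>v. {\<tau> v -` A \<inter> space M | A. A \<in> sets borel}) (- {a, b})"
begin

lemma \<tau>_measurable' [measurable]: "\<tau> v \<in> borel_measurable M"
proof (cases "v \<in> {a, b}")
  case True
  then have "\<tau> v \<in> borel_measurable M \<longleftrightarrow> (\<lambda>_. 0 :: real) \<in> borel_measurable M"
    by (intro measurable_cong) (simp add: \<tau>_seed)
  then show ?thesis
    by simp
qed (rule \<tau>_measurable)

lemma non_seed_exists: "\<exists>v. v \<notin> {a, b}"
proof (rule ccontr)
  assume "\<not> ?thesis"
  then have "{u. E a u} \<subseteq> {a, b}"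
    by blast
  then have "card {u. E a u} \<le> card {a, b}"
    by (intro card_mono) auto
  also have "\<dots> \<le> 2"
    by (simp add: card_insert_if)
  finally show False
    using degree(2)[of a] K_ge_2 by simp
qed

sublocale \<mu>: real_distribution \<mu>
proof -
  obtain v where "v \<notin> {a, b}"
    using non_seed_exists by blast
  then show "real_distribution \<mu>"
    using real_distribution_distr[of "\<tau> v"] \<tau>_distr[of v] by simp
qed

lemma measure_lessThan: "measure \<mu> {..<x} = cdf \<mu> x"
proof -
  have "measure \<mu> ({..<x} \<union> {x}) = measure \<mu> {..<x} + measure \<mu> {x}"
    by (rule \<mu>.finite_measure_Union) auto
  moreover have "measure \<mu> {x} = 0"
    using \<mu>_atomless[of x] by (simp add: measure_def)
  moreover have "{..<x} \<union> {x} = {..x}"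
    by auto
  ultimately show ?thesis
    by (simp add: cdf_def)
qed

lemma quantile_exists:
  assumes "0 < p" "p < 1"
  shows "\<exists>x. cdf \<mu> x = p"
proof -
  have cont: "isCont (cdf \<mu>) x" for x
    using \<mu>_atomless[of x] by (simp add: \<mu>.isCont_cdf measure_def)
  obtain x where x: "cdf \<mu> x < p"
    using order_tendstoD(2)[OF \<mu>.cdf_lim_at_bot assms(1)] by (auto dest: eventually_happens)
  obtain y where y: "p < cdf \<mu> y"
    using order_tendstoD(1)[OF \<mu>.cdf_lim_at_top_prob assms(2)] by (auto dest: eventually_happens)
  have "x \<le> y"
    using x y \<mu>.cdf_nondecreasing[of y x] by linarith
  then have "\<exists>z\<ge>x. z \<le> y \<and> cdf \<mu> z = p"
    using x y cont by (intro IVT) auto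
  then show ?thesis
    by blast
qed

text \<open>
  As the law of the arrival times has no atoms, its quantiles cut the time axis into
  slices of arbitrarily small probability.
\<close>

lemma slices_exist:
  assumes "\<delta> > 0"
  shows "\<exists>n U. U 0 = {} \<and> U n = UNIV \<and> (\<forall>k. U k \<in> sets borel) \<and>
    (\<forall>k x y. x < y \<longrightarrow> y \<in> U k \<longrightarrow> x \<in> U k) \<and>
    (\<forall>k<n. measure \<mu> (U (Suc k) - U k) \<le> \<delta>)"
proof -
  obtain n :: nat where n: "n > 0" "1 / n < \<delta>"
    using assms by (metis nat_approx_posE zero_less_Suc)
  have "\<forall>k. \<exists>x. 0 < k \<and> k < n \<longrightarrow> cdf \<mu> x = k / n"
    using quantile_exists n(1) by (metis divide_less_eq_1_pos of_nat_0_less_iff of_nat_less_iff zero_less_divide_iff)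
  then obtain c where c: "\<And>k. 0 < k \<Longrightarrow> k < n \<Longrightarrow> cdf \<mu> (c k) = k / n"
    by metis
  define U where "U = (\<lambda>k. if k = 0 then {} else if k < n then {..<c k} else UNIV)"
  have meas: "measure \<mu> (U k) = k / n" if "k \<le> n" for k
    using that n c \<mu>.prob_space by (auto simp: U_def measure_lessThan)
  have mono: "U k \<subseteq> U (Suc k)" if "k < n" for k
  proof (cases "0 < k \<and> Suc k < n")
    case True
    have "c k \<le> c (Suc k)"
    proof (rule ccontr)
      assume "\<not> ?thesis"
      then have "cdf \<mu> (c (Suc k)) \<le> cdf \<mu> (c k)"
        by (intro \<mu>.cdf_nondecreasing) simp
      then show False
        using c[of k] c[of "Suc k"] True n(1) by (simp add: field_simps)
    qed
    then show ?thesis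
      using True by (auto simp: U_def)
  qed (use that in \<open>auto simp: U_def\<close>)
  have "measure \<mu> (U (Suc k) - U k) \<le> \<delta>" if "k < n" for k
  proof -
    have "measure \<mu> (U (Suc k) - U k) = measure \<mu> (U (Suc k)) - measure \<mu> (U k)"
      using mono[OF that] by (intro \<mu>.finite_measure_Diff) (auto simp: U_def)
    also have "\<dots> = 1 / n"
      using that meas[of k] meas[of "Suc k"] by (simp add: diff_divide_distrib[symmetric])
    finally show ?thesis
      using n by simp
  qed
  then show ?thesis
    using n(1) by (intro exI[of _ n] exI[of _ U]) (auto simp: U_def)
qed

lemma prob_all_times_in:
  assumes "finite Y" "Y \<inter> {a, b} = {}" "\<And>y. y \<in> Y \<Longrightarrow> B y \<in> sets borel"
  shows "prob {\<omega> \<in> space M. \<forall>y\<in>Y. \<tau> y \<omega> \<in> B y} = (\<Prod>y\<in>Y. measure \<mu> (B y))"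
proof (cases "Y = {}")
  case True
  then show ?thesis
    by (simp add: prob_space)
next
  case False
  have "{\<omega> \<in> space M. \<forall>y\<in>Y. \<tau> y \<omega> \<in> B y} = (\<Inter>y\<in>Y. \<tau> y -` B y \<inter> space M)"
    using False by auto
  also have "prob \<dots> = (\<Prod>y\<in>Y. prob (\<tau> y -` B y \<inter> space M))"
    using assms False by (intro indep_setsD[OF \<tau>_indep]) auto
  also have "\<dots> = (\<Prod>y\<in>Y. measure \<mu> (B y))"
  proof (rule prod.cong[OF refl])
    fix y assume y: "y \<in> Y"
    have "measure (distr M borel (\<tau> y)) (B y) = prob (\<tau> y -` B y \<inter> space M)"
      using assms(3)[OF y] by (intro measure_distr) auto
    moreover have "distr M borel (\<tau> y) = \<mu>"
      using \<tau>_distr[of y] assms(2) y by blast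
    ultimately show "prob (\<tau> y -` B y \<inter> space M) = measure \<mu> (B y)"
      by simp
  qed
  finally show ?thesis .
qed

text \<open>
  The event that is implied by \<open>xs\<close> being a chain to \<open>w\<close> with times in a set
  \<open>J \<subseteq> {s..}\<close>. Replacing the comparison of times by the comparison with the constant \<open>s\<close>
  turns it into a product event.
\<close>

definition walk_event :: "real \<Rightarrow> real set \<Rightarrow> 'v \<Rightarrow> 'v list \<Rightarrow> 'w set" where
  "walk_event s J w xs = {\<omega> \<in> space M. (\<forall>x\<in>set xs. \<tau> x \<omega> \<in> J) \<and>
     (\<forall>y\<in>explored a (Max (d a ` set xs)) w xs. s \<le> \<tau> y \<omega>)}"

lemma walk_event_measurable:
  assumes [measurable]: "J \<in> sets borel"
  shows "walk_event s J w xs \<in> events"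
proof -
  have [measurable]: "finite (explored a (Max (d a ` set xs)) w xs)"
    by (rule finite_explored)
  show ?thesis
    unfolding walk_event_def by measurable
qed

text \<open>
  Each of the explored vertices contributes a factor \<open>q\<close>, except that the vertices of the
  list contribute the smaller factor \<open>\<mu> J\<close>. The explored volume pays for \<open>N\<close> factors
  \<open>q\<close> per unit of length of the long jumps, and the smallness of \<open>\<mu> J\<close> for those of the
  at most \<open>R\<close> units of each short jump. Seeds have time \<open>0\<close>, which is below
  \<open>s\<close>, so the event is empty if a seed is explored.
\<close>

lemma prob_walk_event:
  fixes N R :: nat
  assumes s: "0 < s"
    and J: "J \<in> sets borel" "J \<subseteq> {s..}"
    and q: "q = measure \<mu> {s..}" "0 < q"
    and \<delta>: "measure \<mu> J \<le> q ^ (N * R + 1)"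
    and jumps: "\<And>j. j < length xs \<Longrightarrow> 0 < jump w xs j"
    and apart: "\<And>i j. i < j \<Longrightarrow> j < length xs \<Longrightarrow> jump w xs j \<le> d (xs ! j) (xs ! i)"
    and tail: "\<And>n. (\<Sum>r=R..n. N * r / 2 ^ ((r - 1) div 4) :: real) \<le> 1"
  shows "prob (walk_event s J w xs) \<le> q ^ (N * total_jump w xs)"
proof -
  define W where "W = explored a (Max (d a ` set xs)) w xs"
  have finW: "finite W"
    unfolding W_def by (rule finite_explored)
  show ?thesis
  proof (cases "W \<inter> {a, b} = {}")
    case False
    then obtain y where y: "y \<in> W" "y \<in> {a, b}"
      by blast
    have "walk_event s J w xs = {}"
      using y s \<tau>_seed[of y] unfolding walk_event_def W_def by force
    then show ?thesis
      using q(2) by simp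
  next
    case True
    have q1: "q \<le> 1"
      using q by simp
    have level: "d a (xs ! j) \<le> Max (d a ` set xs)" if "j < length xs" for j
      using that by simp
    have sub: "set xs \<subseteq> W"
    proof
      fix x assume "x \<in> set xs"
      then obtain j where "j < length xs" "x = xs ! j"
        by (auto simp: in_set_conv_nth)
      then show "x \<in> W"
        unfolding W_def explored_def using level[of j] jumps[of j] by auto
    qed
    have "distinct xs"
      unfolding distinct_conv_nth
    proof (intro allI impI)
      fix i j assume ij: "i < length xs" "j < length xs" "i \<noteq> j"
      then consider "i < j" | "j < i"
        by linarith
      then show "xs ! i \<noteq> xs ! j"
        using apart[of i j] apart[of j i] jumps[of i] jumps[of j] ij
        by cases (metis d_refl leD)+
    qed
    then have card_xs: "card (set xs) = length xs"
      by (rule distinct_card)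
    define B where "B = (\<lambda>y. if y \<in> set xs then J else {s..})"
    have "prob (walk_event s J w xs) \<le> prob {\<omega> \<in> space M. \<forall>y\<in>W. \<tau> y \<omega> \<in> B y}"
    proof (rule finite_measure_mono)
      show "walk_event s J w xs \<subseteq> {\<omega> \<in> space M. \<forall>y\<in>W. \<tau> y \<omega> \<in> B y}"
        unfolding walk_event_def W_def B_def by auto
      have "{\<omega> \<in> space M. \<forall>y\<in>W. \<tau> y \<omega> \<in> B y} = {\<omega> \<in> space M. \<forall>y\<in>W. \<omega> \<in> \<tau> y -` B y \<inter> space M}"
        by auto
      also have "\<dots> \<in> events"
        using J finW by (intro sets.sets_Collect_finite_All) (auto simp: B_def)
      finally show "{\<omega> \<in> space M. \<forall>y\<in>W. \<tau> y \<omega> \<in> B y} \<in> events" .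
    qed
    also have "\<dots> = (\<Prod>y\<in>W. measure \<mu> (B y))"
      using J True finW by (intro prob_all_times_in) (auto simp: B_def)
    also have "W = set xs \<union> (W - set xs)"
      using sub by blast
    also have "(\<Prod>y\<in>\<dots>. measure \<mu> (B y)) = (\<Prod>y\<in>set xs. measure \<mu> (B y)) * (\<Prod>y\<in>W - set xs. measure \<mu> (B y))"
      using finW by (intro prod.union_disjoint) auto
    also have "(\<Prod>y\<in>set xs. measure \<mu> (B y)) = measure \<mu> J ^ length xs"
      by (simp add: B_def card_xs)
    also have "(\<Prod>y\<in>W - set xs. measure \<mu> (B y)) = q ^ (card W - length xs)"
      using card_Diff_subset[OF _ sub] by (simp add: B_def q card_xs)
    also have "measure \<mu> J ^ length xs * q ^ (card W - length xs)
        \<le> (q ^ (N * R + 1)) ^ length xs * q ^ (card W - length xs)"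
      using q \<delta> by (intro mult_right_mono power_mono) auto
    also have "\<dots> = q ^ ((N * R + 1) * length xs + (card W - length xs))"
      by (simp only: power_mult power_add)
    also have "\<dots> \<le> q ^ (N * total_jump w xs)"
    proof (rule power_decreasing)
      have "length xs \<le> card W"
        using card_mono[OF finW sub] card_xs by simp
      moreover have "N * total_jump w xs \<le> card W + N * R * length xs"
        unfolding W_def using True level
        by (intro total_jump_le_card_explored apart tail) (auto simp: W_def)
      ultimately show "N * total_jump w xs \<le> (N * R + 1) * length xs + (card W - length xs)"
        by (simp add: algebra_simps)
    qed (use q q1 in auto)
    finally show ?thesis .
  qed
qed

text \<open>
  Within a thin slice of time, the bound on the probability of a walk of length \<open>n\<close> beats the
  number of these walks, and the Borel-Cantelli lemma applies. The choice of \<open>N\<close> makes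
  the expected number of chains of total length \<open>n\<close> at most \<open>2\<close> to the power \<open>- n\<close>.
\<close>

lemma finite_slice_descendants:
  assumes s: "0 < s"
    and q: "q = measure \<mu> {s..}" "0 < q" "q < 1"
  shows "\<exists>\<delta>>0. \<forall>J w. J \<in> sets borel \<longrightarrow> J \<subseteq> {s..} \<longrightarrow> measure \<mu> J \<le> \<delta> \<longrightarrow>
    (AE \<omega> in M. finite (descendants E a (\<lambda>v. \<tau> v \<omega>) J w))"
proof -
  obtain N where N: "q ^ N < 1 / (4 * (K + 1))"
    using real_arch_pow_inv[of "1 / (4 * (K + 1))" q] q by auto
  obtain R where R: "\<And>n. (\<Sum>r=R..n. N * r / 2 ^ ((r - 1) div 4) :: real) \<le> 1"
    using small_tail[of N] by blast
  show ?thesis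
  proof (intro exI[of _ "q ^ (N * R + 1)"] conjI allI impI)
    show "0 < q ^ (N * R + 1)"
      using q by simp
    fix J w assume J: "J \<in> sets borel" "J \<subseteq> {s..}" "measure \<mu> J \<le> q ^ (N * R + 1)"
    define spread where "spread = (\<lambda>xs. \<forall>i j. i < j \<longrightarrow> j < length xs \<longrightarrow> jump w xs j \<le> d (xs ! j) (xs ! i))"
    define S where "S = (\<lambda>n. {xs \<in> walks w n. spread xs})"
    define A where "A = (\<lambda>n. \<Union>xs\<in>S n. walk_event s J w xs)"
    have finS: "finite (S n)" for n
      unfolding S_def using finite_walks by auto
    have A_events: "A n \<in> events" for n
      unfolding A_def using finS walk_event_measurable[OF J(1)] by auto
    have prob_A: "prob (A n) \<le> (1 / 2) ^ n" for n
    proof -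
      have "prob (A n) \<le> (\<Sum>xs\<in>S n. prob (walk_event s J w xs))"
        unfolding A_def using finS walk_event_measurable[OF J(1)]
        by (intro finite_measure_subadditive_finite) auto
      also have "\<dots> \<le> (\<Sum>xs\<in>S n. q ^ (N * n))"
      proof (rule sum_mono)
        fix xs assume xs: "xs \<in> S n"
        then have "prob (walk_event s J w xs) \<le> q ^ (N * total_jump w xs)"
          by (intro prob_walk_event[OF s J(1,2) q(1,2) J(3) _ _ R])
            (auto simp: S_def walks_def spread_def)
        then show "prob (walk_event s J w xs) \<le> q ^ (N * n)"
          using xs by (simp add: S_def walks_def)
      qed
      also have "\<dots> = real (card (S n)) * (q ^ N) ^ n"
        by (simp add: power_mult)
      also have "\<dots> \<le> (2 * (K + 1)) ^ n * (1 / (4 * (K + 1))) ^ n"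
      proof (rule mult_mono)
        have "card (S n) \<le> card (walks w n)"
          using finite_walks by (intro card_mono) (auto simp: S_def)
        also have "\<dots> \<le> (2 * (K + 1)) ^ n"
          by (rule card_walks)
        finally show "real (card (S n)) \<le> (2 * (K + 1)) ^ n"
          by (metis of_nat_le_iff of_nat_power)
        show "(q ^ N) ^ n \<le> (1 / (4 * (K + 1))) ^ n"
          using N q by (intro power_mono) auto
      qed (use q in auto)
      also have "\<dots> = (1 / 2) ^ n"
        by (simp add: power_mult_distrib[symmetric] field_simps)
      finally show ?thesis .
    qed
    have "summable (\<lambda>n. prob (A n))"
      by (rule summable_comparison_test'[of "\<lambda>n. (1 / 2) ^ n"]) (use prob_A in auto)
    then have "AE \<omega> in M. eventually (\<lambda>n. \<omega> \<in> space M - A n) sequentially"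
      using A_events by (intro borel_cantelli_AE1) (auto simp: emeasure_eq_measure)
    then show "AE \<omega> in M. finite (descendants E a (\<lambda>v. \<tau> v \<omega>) J w)"
    proof (rule AE_mp, intro AE_I2 impI)
      fix \<omega> assume \<omega>: "\<omega> \<in> space M" "eventually (\<lambda>n. \<omega> \<in> space M - A n) sequentially"
      then obtain n0 where n0: "\<And>n. n \<ge> n0 \<Longrightarrow> \<omega> \<notin> A n"
        by (auto simp: eventually_sequentially)
      have "descendants E a (\<lambda>v. \<tau> v \<omega>) J w \<subseteq> (\<lambda>xs. last (w # xs)) ` (\<Union>n<n0. walks w n)"
      proof
        fix v assume "v \<in> descendants E a (\<lambda>v. \<tau> v \<omega>) J w"
        then obtain l where "(chain_rel E a l (\<lambda>v. \<tau> v \<omega>) J)\<^sup>*\<^sup>* v w"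
          by (auto simp: descendants_def)
        then obtain xs where xs: "last (w # xs) = v"
          "\<And>j. j < length xs \<Longrightarrow> 0 < jump w xs j"
          "\<And>i j. i < j \<Longrightarrow> j < length xs \<Longrightarrow> jump w xs j \<le> d (xs ! j) (xs ! i)"
          "\<And>x. x \<in> set xs \<Longrightarrow> \<tau> x \<omega> \<in> J"
          "\<And>y. y \<in> explored a (Max (d a ` set xs)) w xs \<Longrightarrow> \<exists>x\<in>set xs. \<tau> x \<omega> \<le> \<tau> y \<omega>"
          by (rule chain_walk) blast
        have "xs \<in> S (total_jump w xs)"
          using xs(2,3) by (auto simp: S_def walks_def spread_def)
        moreover have "\<omega> \<in> walk_event s J w xs"
          unfolding walk_event_def using xs(4,5) \<omega>(1) J(2) by force
        ultimately have "\<omega> \<in> A (total_jump w xs)"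
          by (auto simp: A_def)
        then have "total_jump w xs < n0"
          using n0[of "total_jump w xs"] by linarith
        moreover have "xs \<in> walks w (total_jump w xs)"
          using xs(2) by (simp add: walks_def)
        ultimately show "v \<in> (\<lambda>xs. last (w # xs)) ` (\<Union>n<n0. walks w n)"
          using xs(1) by blast
      qed
      then show "finite (descendants E a (\<lambda>v. \<tau> v \<omega>) J w)"
        by (rule finite_subset) (use finite_walks in auto)
    qed
  qed
qed

lemma descendants_mono: "J \<subseteq> J' \<Longrightarrow> descendants E r t J w \<subseteq> descendants E r t J' w"
proof -
  assume "J \<subseteq> J'"
  then have "(chain_rel E r l t J)\<^sup>*\<^sup>* \<le> (chain_rel E r l t J')\<^sup>*\<^sup>*" for l
    by (intro rtranclp_mono) (auto simp: chain_rel_def)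
  then show ?thesis
    by (auto simp: descendants_def)
qed

text \<open>
  A chain whose times lie above \<open>s\<close> passes through finitely many slices, and within each
  slice every vertex has finitely many descendants.
\<close>

lemma AE_finite_descendants_above:
  assumes s: "0 < s" "0 < cdf \<mu> s" "cdf \<mu> s < 1"
  shows "AE \<omega> in M. \<forall>w. finite (descendants E a (\<lambda>v. \<tau> v \<omega>) {s..} w)"
proof -
  have "measure \<mu> (UNIV - {..<s}) = 1 - cdf \<mu> s"
    using \<mu>.prob_compl[of "{..<s}"] by (simp add: measure_lessThan)
  moreover have "UNIV - {..<s} = {s..}"
    by auto
  ultimately have q: "measure \<mu> {s..} = 1 - cdf \<mu> s"
    by simp
  obtain \<delta> where \<delta>: "\<delta> > 0" "\<And>J w. J \<in> sets borel \<Longrightarrow> J \<subseteq> {s..} \<Longrightarrow> measure \<mu> J \<le> \<delta> \<Longrightarrow>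
      AE \<omega> in M. finite (descendants E a (\<lambda>v. \<tau> v \<omega>) J w)"
    using finite_slice_descendants[OF s(1) refl] q s by auto
  obtain n U where U: "U 0 = {}" "U n = UNIV" "\<And>k. U k \<in> sets borel"
    "\<And>k x y. x < y \<Longrightarrow> y \<in> U k \<Longrightarrow> x \<in> U k"
    "\<And>k. k < n \<Longrightarrow> measure \<mu> (U (Suc k) - U k) \<le> \<delta>"
    using slices_exist[OF \<delta>(1)] by metis
  have "AE \<omega> in M. \<forall>w. finite (descendants E a (\<lambda>v. \<tau> v \<omega>) ({s..} \<inter> U k) w)" if "k \<le> n" for k
    using that
  proof (induction k)
    case 0
    have "descendants E a t {} w \<subseteq> {w}" for t :: "'v \<Rightarrow> real" and w
      by (auto simp: descendants_def chain_rel_def elim: converse_rtranclpE)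
    then have "finite (descendants E a t {} w)" for t :: "'v \<Rightarrow> real" and w
      by (rule finite_subset) simp
    then show ?case
      by (simp add: U(1))
  next
    case (Suc k)
    define J where "J = {s..} \<inter> U (Suc k)"
    have "J - U k \<in> sets borel" "J - U k \<subseteq> {s..}"
      using U(3) by (auto simp: J_def)
    moreover have "measure \<mu> (J - U k) \<le> measure \<mu> (U (Suc k) - U k)"
      using U(3) by (intro \<mu>.finite_measure_mono) (auto simp: J_def)
    then have "measure \<mu> (J - U k) \<le> \<delta>"
      using U(5)[of k] Suc.prems by simp
    ultimately have "AE \<omega> in M. finite (descendants E a (\<lambda>v. \<tau> v \<omega>) (J - U k) w)" for w
      by (rule \<delta>(2))
    then have "AE \<omega> in M. \<forall>w\<in>UNIV. finite (descendants E a (\<lambda>v. \<tau> v \<omega>) (J - U k) w)"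
      by (simp only: AE_ball_countable[OF countable_vertices] ball_simps) blast
    moreover have "AE \<omega> in M. \<forall>w. finite (descendants E a (\<lambda>v. \<tau> v \<omega>) ({s..} \<inter> U k) w)"
      using Suc by simp
    ultimately have "AE \<omega> in M. \<forall>w. finite (descendants E a (\<lambda>v. \<tau> v \<omega>) J w)"
    proof eventually_elim
      case (elim \<omega>)
      show ?case
      proof
        fix w
        have "descendants E a (\<lambda>v. \<tau> v \<omega>) (J \<inter> U k) w \<subseteq> descendants E a (\<lambda>v. \<tau> v \<omega>) ({s..} \<inter> U k) w"
          by (rule descendants_mono) (auto simp: J_def)
        then have "finite (descendants E a (\<lambda>v. \<tau> v \<omega>) (J \<inter> U k) w)"
          using elim(2) finite_subset by blast
        then have "finite (\<Union>x\<in>descendants E a (\<lambda>v. \<tau> v \<omega>) (J \<inter> U k) w. descendants E a (\<lambda>v. \<tau> v \<omega>) (J - U k) x)"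
          using elim(1) by auto
        then show "finite (descendants E a (\<lambda>v. \<tau> v \<omega>) J w)"
          by (rule finite_subset[OF descendants_split[of "U k"], rotated]) (rule U(4))
      qed
    qed
    then show ?case
      by (simp only: J_def)
  qed
  from this[of n] show ?thesis
    by (simp add: U(2))
qed

lemma AE_non_seed_pos: "AE \<omega> in M. \<forall>v. v \<notin> {a, b} \<longrightarrow> 0 < \<tau> v \<omega>"
proof -
  have "AE \<omega> in M. 0 < \<tau> v \<omega>" if "v \<notin> {a, b}" for v
    using \<mu>_pos \<tau>_distr[OF that] by (intro AE_distrD[of "\<tau> v" M borel "\<lambda>x. 0 < x"]) auto
  then have "AE \<omega> in M. \<forall>v\<in>- {a, b}. 0 < \<tau> v \<omega>"
    using countable_subset[OF subset_UNIV countable_vertices] by (subst AE_ball_countable) auto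
  then show ?thesis
    by (rule AE_mp) auto
qed

lemma cdf_pos_imp_pos:
  assumes "0 < cdf \<mu> s"
  shows "0 < s"
proof (rule ccontr)
  assume "\<not> 0 < s"
  have "AE x in \<mu>. x \<notin> {..<s}"
    using \<mu>_pos by (rule AE_mp) (use \<open>\<not> 0 < s\<close> in auto)
  then have "measure \<mu> {..<s} = 0"
    by (subst \<mu>.prob_eq_0) auto
  then show False
    using assms by (simp add: measure_lessThan)
qed

text \<open>
  The arrival time of \<open>u\<close> is almost surely at least some quantile \<open>s n\<close> of positive
  order, and it is a lower bound for the times along every chain to \<open>u\<close>.
\<close>

lemma AE_finite_descendants:
  "AE \<omega> in M. \<forall>u. u \<notin> {a, b} \<longrightarrow> finite (descendants E a (\<lambda>v. \<tau> v \<omega>) UNIV u)"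
proof -
  have "\<exists>x. cdf \<mu> x = 1 / (real n + 2)" for n
    by (rule quantile_exists) auto
  then obtain s where s: "\<And>n. cdf \<mu> (s n) = 1 / (real n + 2)"
    by metis
  have "AE x in \<mu>. \<exists>n. s n \<le> x"
  proof -
    have "measure \<mu> (\<Inter>n. {..<s n}) \<le> 1 / (real n + 2)" for n
    proof -
      have "measure \<mu> (\<Inter>n. {..<s n}) \<le> measure \<mu> {..<s n}"
        by (intro \<mu>.finite_measure_mono) auto
      then show ?thesis
        by (simp add: measure_lessThan s)
    qed
    moreover have "(\<lambda>n. 1 / (real n + 2)) \<longlonglongrightarrow> 0"
      using LIMSEQ_ignore_initial_segment[OF lim_1_over_n[where 'a = real], of 2]
      by (simp add: add.commute)
    ultimately have "measure \<mu> (\<Inter>n. {..<s n}) \<le> 0"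
      by (intro LIMSEQ_le_const) auto
    then have "measure \<mu> (\<Inter>n. {..<s n}) = 0"
      by (simp add: measure_le_0_iff)
    then have "AE x in \<mu>. x \<notin> (\<Inter>n. {..<s n})"
      by (subst (asm) \<mu>.prob_eq_0) auto
    then show ?thesis
      by (rule AE_mp) (auto simp: not_less)
  qed
  then have exceeds: "AE \<omega> in M. \<exists>n. s n \<le> \<tau> u \<omega>" if "u \<notin> {a, b}" for u
    using \<tau>_distr[OF that] by (intro AE_distrD[of "\<tau> u" M borel "\<lambda>x. \<exists>n. s n \<le> x"]) auto
  have "AE \<omega> in M. \<forall>u\<in>- {a, b}. \<exists>n. s n \<le> \<tau> u \<omega>"
    unfolding AE_ball_countable[OF countable_subset[OF subset_UNIV countable_vertices]]
  proof
    fix u assume "u \<in> - {a, b}"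
    then show "AE \<omega> in M. \<exists>n. s n \<le> \<tau> u \<omega>"
      using exceeds[of u] by simp
  qed
  moreover have "AE \<omega> in M. \<forall>w. finite (descendants E a (\<lambda>v. \<tau> v \<omega>) {s n..} w)" for n
    by (rule AE_finite_descendants_above[OF cdf_pos_imp_pos]) (simp_all add: s)
  then have "AE \<omega> in M. \<forall>n w. finite (descendants E a (\<lambda>v. \<tau> v \<omega>) {s n..} w)"
    by (simp add: AE_all_countable)
  ultimately show ?thesis
  proof eventually_elim
    case (elim \<omega>)
    show ?case
    proof (intro allI impI)
      fix u assume "u \<notin> {a, b}"
      then obtain n where n: "s n \<le> \<tau> u \<omega>"
        using elim(1) by blast
      have "(chain_rel E a l (\<lambda>v. \<tau> v \<omega>) {s n..})\<^sup>*\<^sup>* v u \<and> \<tau> u \<omega> \<le> \<tau> v \<omega>"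
        if "(chain_rel E a l (\<lambda>v. \<tau> v \<omega>) UNIV)\<^sup>*\<^sup>* v u" for l v
        using that
      proof (induction rule: converse_rtranclp_induct)
        case (step v v')
        then have "\<tau> v' \<omega> < \<tau> v \<omega>"
          by (simp add: chain_rel_def candidate_parent_def)
        moreover from this have "chain_rel E a l (\<lambda>v. \<tau> v \<omega>) {s n..} v v'"
          using step n by (simp add: chain_rel_def)
        ultimately show ?case
          using step by (auto intro: converse_rtranclp_into_rtranclp)
      qed simp
      then have "descendants E a (\<lambda>v. \<tau> v \<omega>) UNIV u \<subseteq> descendants E a (\<lambda>v. \<tau> v \<omega>) {s n..} u"
        by (auto simp: descendants_def)
      then show "finite (descendants E a (\<lambda>v. \<tau> v \<omega>) UNIV u)"
        using elim(2) finite_subset by blast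
    qed
  qed
qed

end

section \<open>Convergence of the coloring for given arrival times and indexings\<close>

locale coloring = regular_tree_graph E K
  for E :: "'v \<Rightarrow> 'v \<Rightarrow> bool" and K :: nat +
  fixes a b :: 'v and t :: "'v \<Rightarrow> real" and e :: "'v \<Rightarrow> nat \<Rightarrow> 'v"
  assumes odd_dist: "odd (d a b)"
    and seed_time: "t a = 0" "t b = 0"
    and time_pos: "v \<notin> {a, b} \<Longrightarrow> 0 < t v"
    and indexing_bij: "bij (e v)"
    and indexing_mono: "j < i \<Longrightarrow> d v (e v j) \<le> d v (e v i)"
begin

abbreviation p :: "nat \<Rightarrow> 'v \<Rightarrow> 'v" where
  "p l \<equiv> parent E a b l t e"

abbreviation blue :: "nat \<Rightarrow> 'v set" where
  "blue l \<equiv> blue_set E a b l t e"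

abbreviation red :: "nat \<Rightarrow> 'v set" where
  "red l \<equiv> red_set E a b l t e"

lemma seeds_distinct: "a \<noteq> b"
  using odd_dist by auto

lemma no_tie: "d v a \<noteq> d v b"
proof
  assume "d v a = d v b"
  then show False
    using parity[of v a b] odd_dist by simp
qed

lemma parent_seed: "v \<in> {a, b} \<Longrightarrow> p l v = v"
  by (simp add: parent_def)

lemma parent_spec:
  fixes l :: nat
  assumes v: "v \<notin> {a, b}"
  defines "k \<equiv> LEAST j. d a (e v j) \<le> l \<and> t (e v j) < t v"
  shows "p l v = e v k" "d a (e v k) \<le> l" "t (e v k) < t v"
    and "\<And>j. d a (e v j) \<le> l \<Longrightarrow> t (e v j) < t v \<Longrightarrow> k \<le> j"
proof -
  show "p l v = e v k"
    using v by (simp add: parent_def k_def gball_def)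
  obtain j where "e v j = a"
    using indexing_bij[of v] by (metis bij_pointE)
  then have "d a (e v j) \<le> l \<and> t (e v j) < t v"
    using time_pos[OF v] seed_time by simp
  then have "d a (e v k) \<le> l \<and> t (e v k) < t v"
    unfolding k_def by (rule LeastI)
  then show "d a (e v k) \<le> l" "t (e v k) < t v"
    by auto
  show "k \<le> j" if "d a (e v j) \<le> l" "t (e v j) < t v" for j
    unfolding k_def using that by (intro Least_le) simp
qed

lemma parent_nearest:
  assumes "v \<notin> {a, b}" "d a x \<le> l" "t x < t v"
  shows "d v (p l v) \<le> d v x"
proof -
  define k where "k = (LEAST j. d a (e v j) \<le> l \<and> t (e v j) < t v)"
  obtain j where j: "e v j = x"
    using indexing_bij[of v] by (metis bij_pointE)
  then have "k \<le> j"
    unfolding k_def using assms by (intro parent_spec(4)) auto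
  then have "d v (e v k) \<le> d v (e v j)"
    using indexing_mono[of k j v] by (cases "k = j") auto
  then show ?thesis
    using j parent_spec(1)[OF assms(1), of l] by (simp add: k_def)
qed

lemma parent_candidate:
  assumes "v \<notin> {a, b}" "d a v \<le> l"
  shows "candidate_parent E a l t v (p l v)"
  unfolding candidate_parent_def
proof (intro conjI allI impI)
  show "d a (p l v) \<le> l" "t (p l v) < t v"
    using parent_spec(1-3)[OF assms(1), of l] by simp_all
  show "t v \<le> t x" if "d a x \<le> l \<and> d v x < d v (p l v)" for x
    using parent_nearest[OF assms(1), of x l] that by linarith
qed (rule assms)

lemma parent_in_ball: "d a v \<le> l \<Longrightarrow> d a b < l \<Longrightarrow> d a (p l v) \<le> l"
  using parent_seed[of v l] parent_spec(1,2)[of v l] by (cases "v \<in> {a, b}") auto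

lemma ancestor_chain:
  assumes "d a b < l" "d a v \<le> l"
  shows "d a ((p l ^^ n) v) \<le> l \<and> (chain_rel E a l t UNIV)\<^sup>*\<^sup>* v ((p l ^^ n) v)"
proof (induction n)
  case (Suc n)
  let ?w = "(p l ^^ n) v"
  show ?case
  proof (cases "?w \<in> {a, b}")
    case True
    then show ?thesis
      using Suc parent_seed by simp
  next
    case False
    then have "chain_rel E a l t UNIV ?w (p l ?w)"
      using Suc parent_candidate by (simp add: chain_rel_def)
    then show ?thesis
      using Suc parent_in_ball assms by auto
  qed
qed (use assms in simp)

lemma reaches_seed:
  assumes "d a b < l" "d a v \<le> l"
  shows "\<exists>n. (p l ^^ n) v \<in> {a, b}"
  using assms(2)
proof (induction "card {x. d a x \<le> l \<and> t x < t v}" arbitrary: v rule: less_induct)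
  case (less v)
  show ?case
  proof (cases "v \<in> {a, b}")
    case True
    then show ?thesis
      by (intro exI[of _ 0]) simp
  next
    case False
    let ?w = "p l v"
    have w: "d a ?w \<le> l" "t ?w < t v"
      using parent_spec(1-3)[OF False, of l] by simp_all
    have "finite {x. d a x \<le> l \<and> t x < t v}"
      by (rule finite_subset[OF _ finite_ball[of a l]]) auto
    moreover have "{x. d a x \<le> l \<and> t x < t ?w} \<subset> {x. d a x \<le> l \<and> t x < t v}"
      using w by auto
    ultimately have "card {x. d a x \<le> l \<and> t x < t ?w} < card {x. d a x \<le> l \<and> t x < t v}"
      by (rule psubset_card_mono)
    then obtain n where "(p l ^^ n) ?w \<in> {a, b}"
      using less w(1) by blast
    then show ?thesis
      by (intro exI[of _ "Suc n"]) (simp only: funpow_Suc_right o_apply)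
  qed
qed

lemma seed_fixed: "v \<in> {a, b} \<Longrightarrow> (p l ^^ n) v = v"
  by (induction n) (simp_all add: parent_seed)

lemma reaches_one_seed:
  assumes "(p l ^^ m) v = c" "(p l ^^ n) v = c'" "c \<in> {a, b}" "c' \<in> {a, b}"
  shows "c = c'"
proof -
  have *: "x = y" if "(p l ^^ m) v = x" "(p l ^^ n) v = y" "x \<in> {a, b}" "m \<le> n" for x y m n
  proof -
    have "(p l ^^ n) v = (p l ^^ (n - m)) ((p l ^^ m) v)"
      using that(4) funpow_add[of "n - m" m "p l"] by simp
    then show ?thesis
      using that seed_fixed by simp
  qed
  show ?thesis
  proof (cases "m \<le> n")
    case True
    then show ?thesis
      using *[OF assms(1,2,3)] by simp
  next
    case False
    then show ?thesis
      using *[OF assms(2,1,4)] by simp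
  qed
qed

lemma blue_iff_not_red:
  assumes "d a b < l" "d a v \<le> l"
  shows "v \<in> blue l \<longleftrightarrow> v \<notin> red l"
  using reaches_seed[OF assms] reaches_one_seed[where l = l and v = v and c = a and c' = b] seeds_distinct assms
  by (auto simp: blue_set_def red_set_def gball_def)

text \<open>
  If \<open>v\<close> is closer to \<open>c'\<close> but gets the color of \<open>c\<close>, some ancestor \<open>w\<close> on the
  side of \<open>c'\<close> has its parent \<open>u\<close> on the side of \<open>c\<close>. The seed \<open>c'\<close> was
  available as a parent of \<open>w\<close>, so this jump is not longer than the distance from \<open>w\<close> to
  \<open>c'\<close>, and such a jump can only cross to the other side near the seeds.
\<close>

lemma wrong_color_ancestor:
  assumes cc: "{c, c'} = {a, b}" and l: "d a b < l" "d a v \<le> l"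
    and v: "d v c' < d v c" "(p l ^^ n) v = c"
  shows "\<exists>u. u \<notin> {a, b} \<and> d u c' < d a b \<and> v \<in> descendants E a t UNIV u"
proof -
  have D: "d c c' = d a b"
    using cc by (auto simp: doubleton_eq_iff d_sym)
  have seeds: "c \<in> {a, b}" "c' \<in> {a, b}" "c \<noteq> c'"
    using cc seeds_distinct by (auto simp: doubleton_eq_iff)
  have no_tie': "d x c \<noteq> d x c'" for x
    using no_tie[of x] cc by (auto simp: doubleton_eq_iff)
  have "\<not> d ((p l ^^ 0) v) c < d ((p l ^^ 0) v) c'" "d ((p l ^^ n) v) c < d ((p l ^^ n) v) c'"
    using v seeds by auto
  then obtain k where k: "\<not> d ((p l ^^ k) v) c < d ((p l ^^ k) v) c'"
    "d ((p l ^^ Suc k) v) c < d ((p l ^^ Suc k) v) c'"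
    using ex_least_nat_less[of "\<lambda>k. d ((p l ^^ k) v) c < d ((p l ^^ k) v) c'" n] by auto
  define w where "w = (p l ^^ k) v"
  define u where "u = p l w"
  have w: "d w c' < d w c"
    using k(1) no_tie'[of w] by (simp add: w_def)
  have u: "d u c < d u c'"
    using k(2) by (simp add: w_def u_def)
  have non_seed: "w \<notin> {a, b}"
    using parent_seed[of w l] w u by (auto simp: u_def)
  have "d a c' \<le> l"
    using cc l(1) by (auto simp: doubleton_eq_iff)
  moreover have "t c' < t w"
    using time_pos[OF non_seed] seed_time seeds(2) by auto
  ultimately have "d w u \<le> d w c'"
    unfolding u_def by (rule parent_nearest[OF non_seed])
  moreover have "d w u + d c c' = d w c + d u c'"
    using odd_dist D w u by (intro d_crossing) auto
  ultimately have "d u c' < d a b"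
    using w D by linarith
  moreover have "u \<noteq> c'"
    using u by auto
  moreover have "u \<noteq> c"
    using \<open>d u c' < d a b\<close> D by auto
  moreover have "v \<in> descendants E a t UNIV u"
    using ancestor_chain[OF l, of "Suc k"] by (auto simp: descendants_def w_def u_def)
  ultimately show ?thesis
    using cc by blast
qed

end

text \<open>
  This is where the probabilistic input enters: the properties assumed here and in the previous
  locale hold almost surely.
\<close>

locale coloring_finite_descendants = coloring E K a b t e
  for E :: "'v \<Rightarrow> 'v \<Rightarrow> bool" and K :: nat and a b :: 'v and t :: "'v \<Rightarrow> real"
    and e :: "'v \<Rightarrow> nat \<Rightarrow> 'v" +
  assumes finite_descendants: "u \<notin> {a, b} \<Longrightarrow> finite (descendants E a t UNIV u)"
begin

definition exceptional :: "'v set" where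
  "exceptional = (\<Union>u\<in>{u. d a u \<le> d a b \<or> d b u \<le> d a b} - {a, b}. descendants E a t UNIV u)"

lemma finite_exceptional: "finite exceptional"
proof -
  have "{u. d a u \<le> d a b \<or> d b u \<le> d a b} = {u. d a u \<le> d a b} \<union> {u. d b u \<le> d a b}"
    by auto
  then show ?thesis
    using finite_descendants finite_ball by (auto simp: exceptional_def)
qed

lemma nearest_seed_color:
  assumes l: "d a b < l" "d a v \<le> l" and v: "v \<notin> exceptional"
  shows "d v b < d v a \<Longrightarrow> v \<in> red l" "d v a < d v b \<Longrightarrow> v \<in> blue l"
proof -
  have *: "(p l ^^ n) v \<noteq> c" if cc: "{c, c'} = {a, b}" and closer: "d v c' < d v c" for n c c'
  proof
    assume "(p l ^^ n) v = c"
    then obtain u where "u \<notin> {a, b}" "d u c' < d a b" "v \<in> descendants E a t UNIV u"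
      using wrong_color_ancestor[OF cc l closer] by blast
    moreover have "c' \<in> {a, b}"
      using cc by auto
    ultimately show False
      using v by (auto simp: exceptional_def d_sym)
  qed
  show "v \<in> red l" if "d v b < d v a"
    using *[of a b] that blue_iff_not_red[OF l] by (auto simp: blue_set_def)
  show "v \<in> blue l" if "d v a < d v b"
    using *[of b a] that blue_iff_not_red[OF l] by (auto simp: red_set_def)
qed

text \<open>
  The seed \<open>a\<close> is available as a parent, so \<open>v\<close> looks no further than \<open>d a v\<close> and does
  not notice a truncation beyond level \<open>2 * d a v\<close>.
\<close>

lemma parent_stable:
  assumes "2 * d a v \<le> l" "l \<le> l'"
  shows "p l v = p l' v"
proof (cases "v \<in> {a, b}")
  case True
  then show ?thesis
    by (simp add: parent_seed)
next
  case False
  define k where "k l = (LEAST j. d a (e v j) \<le> l \<and> t (e v j) < t v)" for l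
  note spec = parent_spec[OF False, folded k_def]
  have "d v (p l' v) \<le> d v a"
    using time_pos[OF False] seed_time by (intro parent_nearest[OF False]) auto
  then have "d a (e v (k l')) \<le> l"
    using d_triangle[of a "e v (k l')" v] assms(1) spec(1)[of l'] by (simp add: d_sym)
  then have "k l \<le> k l'"
    by (intro spec(4) spec(3))
  moreover have "k l' \<le> k l"
    using spec(2)[of l] assms(2) by (intro spec(4) spec(3)) simp
  ultimately show ?thesis
    using spec(1) by simp
qed

lemma color_parent:
  assumes "d a b < l" "d a v \<le> l" "v \<notin> {a, b}"
  shows "v \<in> blue l \<longleftrightarrow> p l v \<in> blue l" "v \<in> red l \<longleftrightarrow> p l v \<in> red l"
proof -
  have "(\<exists>n. (p l ^^ n) v = c) \<longleftrightarrow> (\<exists>n. (p l ^^ n) (p l v) = c)" if c: "c \<in> {a, b}" for c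
  proof
    assume "\<exists>n. (p l ^^ n) v = c"
    then obtain n where n: "(p l ^^ n) v = c"
      by blast
    then obtain m where "n = Suc m"
      using assms(3) c by (cases n) auto
    then show "\<exists>n. (p l ^^ n) (p l v) = c"
      using n by (auto simp: funpow_swap1)
  next
    assume "\<exists>n. (p l ^^ n) (p l v) = c"
    then obtain n where "(p l ^^ n) (p l v) = c"
      by blast
    then show "\<exists>n. (p l ^^ n) v = c"
      by (intro exI[of _ "Suc n"]) (simp add: funpow_swap1)
  qed
  then show "v \<in> blue l \<longleftrightarrow> p l v \<in> blue l" "v \<in> red l \<longleftrightarrow> p l v \<in> red l"
    using parent_in_ball assms by (auto simp: blue_set_def red_set_def gball_def)
qed

text \<open>
  Outside the exceptional set the color is that of the nearest seed. A vertex of the exceptional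
  set inherits its color from its parent, which is the same in all large truncated trees and has
  arrived earlier. As the exceptional set is finite, this recursion ends.
\<close>

lemma color_eventually_constant:
  "(\<forall>\<^sub>F l in sequentially. v \<in> blue l) \<or> (\<forall>\<^sub>F l in sequentially. v \<in> red l)"
proof -
  have large: "\<forall>\<^sub>F l in sequentially. d a b < l \<and> d a v \<le> l" for v
    by (intro eventually_conj eventually_gt_at_top eventually_ge_at_top)
  have regular: "(\<forall>\<^sub>F l in sequentially. v \<in> blue l) \<or> (\<forall>\<^sub>F l in sequentially. v \<in> red l)"
    if "v \<notin> exceptional" for v
  proof (cases "d v b < d v a")
    case True
    have "\<forall>\<^sub>F l in sequentially. v \<in> red l"
      using large[of v] by eventually_elim (use nearest_seed_color(1) that True in blast)
    then show ?thesis ..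
  next
    case False
    then have "d v a < d v b"
      using no_tie[of v] by simp
    have "\<forall>\<^sub>F l in sequentially. v \<in> blue l"
      using large[of v] by eventually_elim (use nearest_seed_color(2) that \<open>d v a < d v b\<close> in blast)
    then show ?thesis ..
  qed
  show ?thesis
  proof (induction "card {x \<in> exceptional. t x < t v}" arbitrary: v rule: less_induct)
    case (less v)
    show ?case
    proof (cases "v \<in> {a, b}")
      case True
      have "\<forall>\<^sub>F l in sequentially. a \<in> blue l"
        by (rule always_eventually) (auto simp: blue_set_def gball_def intro: exI[of _ 0])
      moreover have "\<forall>\<^sub>F l in sequentially. b \<in> red l"
        using large[of b] by eventually_elim (auto simp: red_set_def gball_def intro: exI[of _ 0])
      ultimately show ?thesis
        using True by auto
    next
      case False
      define w where "w = p (2 * d a v) v"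
      have w: "t w < t v"
        using parent_spec(1,3)[OF False] by (simp add: w_def)
      have w_colored: "(\<forall>\<^sub>F l in sequentially. w \<in> blue l) \<or> (\<forall>\<^sub>F l in sequentially. w \<in> red l)"
      proof (cases "w \<in> exceptional")
        case True
        then have "{x \<in> exceptional. t x < t w} \<subset> {x \<in> exceptional. t x < t v}"
          using w by auto
        then have "card {x \<in> exceptional. t x < t w} < card {x \<in> exceptional. t x < t v}"
          using finite_exceptional by (intro psubset_card_mono) auto
        then show ?thesis
          by (rule less)
      qed (rule regular)
      have same: "\<forall>\<^sub>F l in sequentially. (v \<in> blue l \<longleftrightarrow> w \<in> blue l) \<and> (v \<in> red l \<longleftrightarrow> w \<in> red l)"
        using large[of v] eventually_ge_at_top[of "2 * d a v"]
        by eventually_elim (use color_parent[OF _ _ False] parent_stable[of v "2 * d a v"] in \<open>simp add: w_def\<close>)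
      have "\<forall>\<^sub>F l in sequentially. v \<in> blue l" if "\<forall>\<^sub>F l in sequentially. w \<in> blue l"
        using that same by eventually_elim blast
      moreover have "\<forall>\<^sub>F l in sequentially. v \<in> red l" if "\<forall>\<^sub>F l in sequentially. w \<in> red l"
        using that same by eventually_elim blast
      ultimately show ?thesis
        using w_colored by blast
    qed
  qed
qed

definition blue_limit :: "'v set" where
  "blue_limit = {v. \<forall>\<^sub>F l in sequentially. v \<in> blue l}"

definition red_limit :: "'v set" where
  "red_limit = {v. \<forall>\<^sub>F l in sequentially. v \<in> red l}"

lemma color_eventually_limit:
  "\<forall>\<^sub>F l in sequentially. (v \<in> blue l \<longleftrightarrow> v \<in> blue_limit) \<and> (v \<in> red l \<longleftrightarrow> v \<in> red_limit)"
proof -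
  have large: "\<forall>\<^sub>F l in sequentially. d a b < l \<and> d a v \<le> l"
    by (intro eventually_conj eventually_gt_at_top eventually_ge_at_top)
  have not_both: "\<not> (v \<in> blue_limit \<and> v \<in> red_limit)"
  proof
    assume "v \<in> blue_limit \<and> v \<in> red_limit"
    then have "\<forall>\<^sub>F l in sequentially. v \<in> blue l" "\<forall>\<^sub>F l in sequentially. v \<in> red l"
      by (simp_all add: blue_limit_def red_limit_def)
    with large have "\<forall>\<^sub>F l::nat in sequentially. False"
      by eventually_elim (use blue_iff_not_red in blast)
    then show False
      by simp
  qed
  from color_eventually_constant[of v] show ?thesis
  proof
    assume *: "\<forall>\<^sub>F l in sequentially. v \<in> blue l"
    then have "v \<in> blue_limit" "v \<notin> red_limit"
      using not_both by (simp_all add: blue_limit_def)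
    then show ?thesis
      using eventually_conj[OF * large] by (auto elim!: eventually_mono simp: blue_iff_not_red)
  next
    assume *: "\<forall>\<^sub>F l in sequentially. v \<in> red l"
    then have "v \<in> red_limit" "v \<notin> blue_limit"
      using not_both by (simp_all add: red_limit_def)
    then show ?thesis
      using eventually_conj[OF * large] by (auto elim!: eventually_mono simp: blue_iff_not_red)
  qed
qed

lemma coloring_locally_converges:
  "locally_converges E a (d a b) blue red blue_limit red_limit"
  unfolding locally_converges_def
proof
  fix N
  have "\<forall>\<^sub>F l in sequentially. \<forall>v\<in>gball E a N. (v \<in> blue l \<longleftrightarrow> v \<in> blue_limit) \<and> (v \<in> red l \<longleftrightarrow> v \<in> red_limit)"
    using finite_ball[of a N] color_eventually_limit
    by (intro eventually_ball_finite) (auto simp: gball_def)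
  then obtain L where L: "\<And>l. l \<ge> L \<Longrightarrow> \<forall>v\<in>gball E a N. (v \<in> blue l \<longleftrightarrow> v \<in> blue_limit) \<and> (v \<in> red l \<longleftrightarrow> v \<in> red_limit)"
    by (auto simp: eventually_sequentially)
  show "\<exists>L>d a b. \<forall>l\<ge>L. blue l \<inter> gball E a N = blue_limit \<inter> gball E a N \<and>
      red l \<inter> gball E a N = red_limit \<inter> gball E a N"
    by (intro exI[of _ "max L (Suc (d a b))"] conjI allI impI set_eqI) (use L in auto)
qed

lemma finite_wrong_color:
  "finite (blue_limit \<inter> {v. d v a > d v b})" "finite (red_limit \<inter> {v. d v a < d v b})"
proof -
  have large: "\<forall>\<^sub>F l in sequentially. d a b < l \<and> d a v \<le> l" for v
    by (intro eventually_conj eventually_gt_at_top eventually_ge_at_top)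
  have *: "\<exists>l. d a b < l \<and> d a v \<le> l \<and> (v \<in> blue l \<longleftrightarrow> v \<in> blue_limit) \<and> (v \<in> red l \<longleftrightarrow> v \<in> red_limit)" for v
    using eventually_happens[OF eventually_conj[OF large[of v] color_eventually_limit[of v]]] by auto
  have "blue_limit \<inter> {v. d v a > d v b} \<subseteq> exceptional"
  proof
    fix v assume "v \<in> blue_limit \<inter> {v. d v a > d v b}"
    then show "v \<in> exceptional"
      using *[of v] nearest_seed_color(1) blue_iff_not_red by blast
  qed
  then show "finite (blue_limit \<inter> {v. d v a > d v b})"
    by (rule finite_subset) (rule finite_exceptional)
  have "red_limit \<inter> {v. d v a < d v b} \<subseteq> exceptional"
  proof
    fix v assume "v \<in> red_limit \<inter> {v. d v a < d v b}"
    then show "v \<in> exceptional"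
      using *[of v] nearest_seed_color(2) blue_iff_not_red by blast
  qed
  then show "finite (red_limit \<inter> {v. d v a < d v b})"
    by (rule finite_subset) (rule finite_exceptional)
qed

end

section \<open>Measurability and conclusion\<close>

lemma measurable_parent_map:
  fixes M :: "'w measure" and \<tau> :: "'v \<Rightarrow> 'w \<Rightarrow> real" and z :: "'v \<Rightarrow> 'w \<Rightarrow> nat \<Rightarrow> 'v"
  assumes countable: "countable (UNIV :: 'v set)"
    and \<tau>: "\<And>v. \<tau> v \<in> borel_measurable M"
    and z: "\<And>v. z v \<in> M \<rightarrow>\<^sub>M enum_space"
  shows "(\<lambda>\<omega>. parent E a b l (\<lambda>v. \<tau> v \<omega>) (\<lambda>v. z v \<omega>) v) \<in> M \<rightarrow>\<^sub>M count_space UNIV"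
proof (cases "v \<in> {a, b}")
  case True
  then show ?thesis
    by (simp add: parent_def)
next
  case False
  have z_j: "(\<lambda>\<omega>. z v \<omega> j) \<in> M \<rightarrow>\<^sub>M count_space UNIV" for j
  proof -
    have "(\<lambda>f. f j) \<in> enum_space \<rightarrow>\<^sub>M count_space (UNIV :: 'v set)"
      unfolding enum_space_def by (rule measurable_component_singleton) simp
    then show ?thesis
      by (rule measurable_compose[OF z])
  qed
  have [measurable]: "Measurable.pred M (\<lambda>\<omega>. z v \<omega> j \<in> gball E a l)" for j
    by (rule measurable_compose[OF z_j]) simp
  have "(\<lambda>\<omega>. \<tau> (z v \<omega> j) \<omega>) \<in> borel_measurable M" for j
    by (rule measurable_compose_countable'[where f = \<tau> and I = UNIV]) (simp_all add: countable z_j \<tau>)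
  then have [measurable]: "Measurable.pred M (\<lambda>\<omega>. \<tau> (z v \<omega> j) \<omega> < \<tau> v \<omega>)" for j
    by (rule borel_measurable_pred_less) (rule \<tau>)
  have least: "(\<lambda>\<omega>. LEAST j. z v \<omega> j \<in> gball E a l \<and> \<tau> (z v \<omega> j) \<omega> < \<tau> v \<omega>) \<in> M \<rightarrow>\<^sub>M count_space UNIV"
    by measurable
  have "(\<lambda>\<omega>. z v \<omega> (LEAST j. z v \<omega> j \<in> gball E a l \<and> \<tau> (z v \<omega> j) \<omega> < \<tau> v \<omega>)) \<in> M \<rightarrow>\<^sub>M count_space UNIV"
    by (rule measurable_compose_countable'[where f = "\<lambda>j \<omega>. z v \<omega> j", OF z_j least]) simp
  then show ?thesis
    using False by (simp add: parent_def)
qed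

lemma measurable_parent_iterate:
  fixes M :: "'w measure" and \<tau> :: "'v \<Rightarrow> 'w \<Rightarrow> real" and z :: "'v \<Rightarrow> 'w \<Rightarrow> nat \<Rightarrow> 'v"
  assumes "countable (UNIV :: 'v set)"
    and "\<And>v. \<tau> v \<in> borel_measurable M"
    and "\<And>v. z v \<in> M \<rightarrow>\<^sub>M enum_space"
  shows "(\<lambda>\<omega>. (parent E a b l (\<lambda>v. \<tau> v \<omega>) (\<lambda>v. z v \<omega>) ^^ n) v) \<in> M \<rightarrow>\<^sub>M count_space UNIV"
proof (induction n)
  case (Suc n)
  show ?case
    unfolding funpow.simps o_apply
    by (rule measurable_compose_countable'[where I = UNIV,
          OF measurable_parent_map[OF assms] Suc assms(1)])
qed simp

lemma random_vertex_set_eventually: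
  assumes "\<And>l. random_vertex_set M (X l)"
  shows "random_vertex_set M (\<lambda>\<omega>. {v. \<forall>\<^sub>F l in sequentially. v \<in> X l \<omega>})"
  using assms unfolding random_vertex_set_def
  by (auto intro!: sets_Collect_eventually_sequentially)

lemma random_vertex_set_color:
  fixes M :: "'w measure" and \<tau> :: "'v \<Rightarrow> 'w \<Rightarrow> real" and z :: "'v \<Rightarrow> 'w \<Rightarrow> nat \<Rightarrow> 'v"
  assumes "countable (UNIV :: 'v set)"
    and "\<And>v. \<tau> v \<in> borel_measurable M"
    and "\<And>v. z v \<in> M \<rightarrow>\<^sub>M enum_space"
  shows "random_vertex_set M (\<lambda>\<omega>. blue_set E a b l (\<lambda>v. \<tau> v \<omega>) (\<lambda>v. z v \<omega>))"
    and "random_vertex_set M (\<lambda>\<omega>. red_set E a b l (\<lambda>v. \<tau> v \<omega>) (\<lambda>v. z v \<omega>))"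
proof -
  have [measurable]: "Measurable.pred M (\<lambda>\<omega>. (parent E a b l (\<lambda>v. \<tau> v \<omega>) (\<lambda>v. z v \<omega>) ^^ n) v = c)" for n v c
    by (rule measurable_compose[OF measurable_parent_iterate[OF assms]]) simp
  show "random_vertex_set M (\<lambda>\<omega>. blue_set E a b l (\<lambda>v. \<tau> v \<omega>) (\<lambda>v. z v \<omega>))"
    unfolding random_vertex_set_def blue_set_def mem_Collect_eq by measurable
  show "random_vertex_set M (\<lambda>\<omega>. red_set E a b l (\<lambda>v. \<tau> v \<omega>) (\<lambda>v. z v \<omega>))"
    unfolding random_vertex_set_def red_set_def mem_Collect_eq by measurable
qed

theorem proposition7:
  fixes K :: nat
    and E :: "'v \<Rightarrow> 'v \<Rightarrow> bool"
    and a b :: 'v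
    and M :: "'w measure"
    and \<mu> :: "real measure"
    and \<tau> :: "'v \<Rightarrow> 'w \<Rightarrow> real"
    and z :: "'v \<Rightarrow> 'w \<Rightarrow> nat \<Rightarrow> 'v"
  assumes "K \<ge> 2"
    and "regular_tree (K + 1) E"
    and "odd (gdist E a b)"
    and "prob_space M"
    and "AE x in \<mu>. x > 0"
    and "\<And>x. emeasure \<mu> {x} = 0"
    and "\<And>v. v \<notin> {a, b} \<Longrightarrow> \<tau> v \<in> borel_measurable M"
    and "\<And>v. v \<notin> {a, b} \<Longrightarrow> distr M borel (\<tau> v) = \<mu>"
    and "\<And>v \<omega>. v \<in> {a, b} \<Longrightarrow> \<omega> \<in> space M \<Longrightarrow> \<tau> v \<omega> = 0"
    and "\<And>w. uniform_increasing_indexing E M w (z w)"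
    and "prob_space.indep_sets M
           (\<lambda>i. case i of Inl v \<Rightarrow> {\<tau> v -` A \<inter> space M | A. A \<in> sets borel}
                        | Inr w \<Rightarrow> {z w -` A \<inter> space M | A. A \<in> sets enum_space})
           ((- {a, b}) <+> UNIV)"
  shows "\<exists>Binf Rinf :: 'w \<Rightarrow> 'v set.
           random_vertex_set M Binf \<and> random_vertex_set M Rinf \<and>
           (AE \<omega> in M. locally_converges E a (gdist E a b)
              (\<lambda>l. blue_set E a b l (\<lambda>v. \<tau> v \<omega>) (\<lambda>v. z v \<omega>))
              (\<lambda>l. red_set E a b l (\<lambda>v. \<tau> v \<omega>) (\<lambda>v. z v \<omega>))
              (Binf \<omega>) (Rinf \<omega>)) \<and>
           (AE \<omega> in M. finite (Binf \<omega> \<inter> {v. gdist E v a > gdist E v b})) \<and>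
           (AE \<omega> in M. finite (Rinf \<omega> \<inter> {v. gdist E v a < gdist E v b}))"
proof -
  interpret prob_space M
    by (rule assms(4))
  interpret regular_tree_graph E K
    using assms(1,2) by unfold_locales (auto simp: regular_tree_def)
  have indep: "indep_sets (\<lambda>v. {\<tau> v -` A \<inter> space M | A. A \<in> sets borel}) (- {a, b})"
  proof (rule indep_setsI)
    show "{\<tau> v -` A \<inter> space M | A. A \<in> sets borel} \<subseteq> events" if "v \<in> - {a, b}" for v
      using measurable_sets[OF assms(7)[of v]] that by auto
    fix A J assume J: "J \<noteq> {}" "J \<subseteq> - {a, b}" "finite J"
      and A: "\<forall>v\<in>J. A v \<in> {\<tau> v -` A \<inter> space M | A. A \<in> sets borel}"
    have "prob (\<Inter>i\<in>(Inl ` J :: ('v + 'v) set). A (projl i)) = (\<Prod>i\<in>(Inl ` J :: ('v + 'v) set). prob (A (projl i)))"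
      by (rule indep_setsD[OF assms(11)]) (use J A in auto)
    then show "prob (\<Inter>v\<in>J. A v) = (\<Prod>v\<in>J. prob (A v))"
      by (simp add: prod.reindex)
  qed
  interpret arrival_times E K M a b \<mu> \<tau>
    by unfold_locales (use assms(5-9) indep in blast)+
  have z_measurable: "z v \<in> M \<rightarrow>\<^sub>M enum_space" for v
    using assms(10)[of v] by (simp add: uniform_increasing_indexing_def)
  have "AE \<omega> in M. bij (z v \<omega>) \<and> (\<forall>i j. j < i \<longrightarrow> d v (z v \<omega> j) \<le> d v (z v \<omega> i))" for v
    using assms(10)[of v] unfolding uniform_increasing_indexing_def by blast
  then have "AE \<omega> in M. \<forall>v\<in>UNIV. bij (z v \<omega>) \<and> (\<forall>i j. j < i \<longrightarrow> d v (z v \<omega> j) \<le> d v (z v \<omega> i))"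
    unfolding AE_ball_countable[OF countable_vertices] by blast
  moreover note AE_non_seed_pos AE_finite_descendants AE_space
  ultimately have good: "AE \<omega> in M. coloring_finite_descendants E K a b (\<lambda>v. \<tau> v \<omega>) (\<lambda>v. z v \<omega>)"
  proof eventually_elim
    case (elim \<omega>)
    then show ?case
      using assms(3,9) by unfold_locales auto
  qed
  \<comment> \<open>The lower limits of the colored sets are measurable and defined on the whole space.\<close>
  define Binf where "Binf = (\<lambda>\<omega>. {v. \<forall>\<^sub>F l in sequentially. v \<in> blue_set E a b l (\<lambda>v. \<tau> v \<omega>) (\<lambda>v. z v \<omega>)})"
  define Rinf where "Rinf = (\<lambda>\<omega>. {v. \<forall>\<^sub>F l in sequentially. v \<in> red_set E a b l (\<lambda>v. \<tau> v \<omega>) (\<lambda>v. z v \<omega>)})"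
  have limits: "coloring_finite_descendants.blue_limit E a b (\<lambda>v. \<tau> v \<omega>) (\<lambda>v. z v \<omega>) = Binf \<omega>"
    "coloring_finite_descendants.red_limit E a b (\<lambda>v. \<tau> v \<omega>) (\<lambda>v. z v \<omega>) = Rinf \<omega>"
    if "coloring_finite_descendants E K a b (\<lambda>v. \<tau> v \<omega>) (\<lambda>v. z v \<omega>)" for \<omega>
    by (simp_all add: Binf_def Rinf_def coloring_finite_descendants.blue_limit_def[OF that]
        coloring_finite_descendants.red_limit_def[OF that])
  show ?thesis
  proof (rule exI[of _ Binf], rule exI[of _ Rinf], intro conjI)
    show "random_vertex_set M Binf" "random_vertex_set M Rinf"
      unfolding Binf_def Rinf_def
      by (intro random_vertex_set_eventually random_vertex_set_color countable_vertices
          \<tau>_measurable' z_measurable)+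
    show "AE \<omega> in M. locally_converges E a (d a b)
        (\<lambda>l. blue_set E a b l (\<lambda>v. \<tau> v \<omega>) (\<lambda>v. z v \<omega>))
        (\<lambda>l. red_set E a b l (\<lambda>v. \<tau> v \<omega>) (\<lambda>v. z v \<omega>)) (Binf \<omega>) (Rinf \<omega>)"
      using good by eventually_elim
        (use coloring_finite_descendants.coloring_locally_converges limits in metis)
    show "AE \<omega> in M. finite (Binf \<omega> \<inter> {v. d v a > d v b})"
      using good by eventually_elim
        (use coloring_finite_descendants.finite_wrong_color(1) limits in metis)
    show "AE \<omega> in M. finite (Rinf \<omega> \<inter> {v. d v a < d v b})"
      using good by eventually_elim
        (use coloring_finite_descendants.finite_wrong_color(2) limits in metis)
  qed
qed

end
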